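(* Let $n\ge 1$ and $p\ge 1$. There exists a sequence of centered probability measures $d\mu_k=f_k\,d\gamma$ in $\mathcal{P}_2(\mathbb{R}^n)$ such that $\lim_{k\to\infty}\delta(\mu_k)=0$ and $\lim_{k\to\infty}W_p(\mu_k,\gamma)=\infty$.
   Context: $d\gamma=(2\pi)^{-n/2}e^{-|x|^2/2}\,dx$ is the standard Gaussian measure on $\mathbb{R}^n$. For a probability measure $d\mu=f\,d\gamma$ with $f\ge 0$ in $L^1(d\gamma)$, the Fisher information and relative entropy are $$\mathrm{I}(\mu)=\int_{\mathbb{R}^n}\frac{|\nabla f|^2}{f}\,d\gamma,\qquad \mathrm{H}(\mu)=\int_{\mathbb{R}^n}f\log f\,d\gamma,$$ and the deficit of the logarithmic Sobolev inequality is $\delta(\mu)=\frac12\mathrm{I}(\mu)-\mathrm{H}(\mu)\ge 0$. Centered means the barycenter $\int x\,d\mu$ is $0$. For $p\ge1$, $\mathcal{P}_p(\mathbb{R}^n)$ is the set of probability measures $\mu$ on $\mathbb{R}^n$ with finite $p$-th moment $m_p(\mu)=\int|x|^p\,d\mu$. For $\mu,\nu\in\mathcal{P}_p(\mathbb{R}^n)$, the Wasserstein distance of order $p$ is $W_p(\mu,\nu)=\inf_\pi\left(\iint|x-y|^p\,d\pi(x,y)\right)^{1/p}$, the infimum being over all probability measures $\pi$ on $\mathbb{R}^n\times\mathbb{R}^n$ with marginals $\mu$ and $\nu$. *)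

theory Defs
  imports "HOL-Probability.Probability"
begin

definition std_gaussian :: "(real ^ 'n) measure" where
  "std_gaussian = density lborel
     (\<lambda>x. ennreal ((2 * pi) powr (- real CARD('n) / 2) * exp (- (norm x)\<^sup>2 / 2)))"

definition gauss_measure :: "(real ^ 'n \<Rightarrow> real) \<Rightarrow> (real ^ 'n) measure" where
  "gauss_measure f = density std_gaussian (\<lambda>x. ennreal (f x))"

definition locally_integrable :: "(real ^ 'n \<Rightarrow> 'b::euclidean_space) \<Rightarrow> bool" where
  "locally_integrable f \<longleftrightarrow> (\<forall>K. compact K \<longrightarrow> set_integrable lborel K f)"

text \<open>Weak (distributional) gradient, tested against compactly supported \<open>C\<^sup>1\<close> functions;
  by mollification the \<open>C\<^sup>\<infinity>\<close> test functions determine the same notion.\<close>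

definition is_weak_gradient ::
  "(real ^ 'n \<Rightarrow> real) \<Rightarrow> (real ^ 'n \<Rightarrow> real ^ 'n) \<Rightarrow> bool" where
  "is_weak_gradient f G \<longleftrightarrow>
     locally_integrable f \<and> locally_integrable G \<and>
     (\<forall>\<phi> D. (\<forall>x. GDERIV \<phi> x :> D x) \<and> continuous_on UNIV D \<and> compact (closure {x. \<phi> x \<noteq> 0})
        \<longrightarrow> (LINT x|lborel. f x *\<^sub>R D x) = - (LINT x|lborel. \<phi> x *\<^sub>R G x))"

text \<open>The weak gradient is unique up to null sets, so the choice below does not matter.
  It vanishes almost everywhere on \<open>{f = 0}\<close>, so the integrand is \<open>0\<close> there
  (\<open>0 / 0 = 0\<close>). A density without a weak gradient has infinite Fisher information.\<close>

definition fisher_information :: "(real ^ 'n \<Rightarrow> real) \<Rightarrow> ennreal" where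
  "fisher_information f =
     (if \<exists>G. is_weak_gradient f G
      then \<integral>\<^sup>+ x. ennreal ((norm ((SOME G. is_weak_gradient f G) x))\<^sup>2 / f x) \<partial>std_gaussian
      else \<infinity>)"

text \<open>The extended-valued integral of \<open>f log f\<close>, as positive part minus negative part. The
  negative part is finite because \<open>t log t \<ge> - 1 / e\<close>. Note that \<open>0 * ln 0 = 0\<close>.\<close>

definition rel_entropy :: "(real ^ 'n \<Rightarrow> real) \<Rightarrow> ereal" where
  "rel_entropy f =
     enn2ereal (\<integral>\<^sup>+ x. ennreal (f x * ln (f x)) \<partial>std_gaussian)
     - enn2ereal (\<integral>\<^sup>+ x. ennreal (- (f x * ln (f x))) \<partial>std_gaussian)"

text \<open>If both terms are infinite, the difference is \<open>\<infinity> - \<infinity> = \<infinity>\<close> in \<open>ereal\<close>.\<close>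

definition lsi_deficit :: "(real ^ 'n \<Rightarrow> real) \<Rightarrow> ereal" where
  "lsi_deficit f = enn2ereal (fisher_information f) / 2 - rel_entropy f"

definition prob_moment :: "real \<Rightarrow> (real ^ 'n) measure set" where
  "prob_moment p =
     {\<mu>. prob_space \<mu> \<and> sets \<mu> = sets borel \<and> integrable \<mu> (\<lambda>x. norm x powr p)}"

definition centered :: "(real ^ 'n) measure \<Rightarrow> bool" where
  "centered \<mu> \<longleftrightarrow> (LINT x|\<mu>. x) = 0"

definition couplings ::
  "(real ^ 'n) measure \<Rightarrow> (real ^ 'n) measure \<Rightarrow> ((real ^ 'n) \<times> (real ^ 'n)) measure set" where
  "couplings \<mu> \<nu> =
     {\<pi>. prob_space \<pi> \<and> sets \<pi> = sets (borel \<Otimes>\<^sub>M borel) \<and>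
         distr \<pi> borel fst = \<mu> \<and> distr \<pi> borel snd = \<nu>}"

text \<open>Meaningful only for \<open>\<mu>\<close>, \<open>\<nu>\<close> in \<open>prob_moment p\<close>, where every cost below is
  a finite integral.\<close>

definition wasserstein :: "real \<Rightarrow> (real ^ 'n) measure \<Rightarrow> (real ^ 'n) measure \<Rightarrow> real" where
  "wasserstein p \<mu> \<nu> =
     (INF \<pi>\<in>couplings \<mu> \<nu>. (LINT z|\<pi>. norm (fst z - snd z) powr p) powr (1 / p))"

end

theory Submission
  imports Defs "HOL-Real_Asymp.Real_Asymp"
begin

text \<open>
  Take the mixture \<open>u \<gamma>\<^sub>b + v \<gamma>\<^sub>c\<close> of two translates of the Gaussian, with \<open>v = 1 / N\<close>,
  \<open>u = 1 - v\<close>, \<open>b = - N e\<close> and \<open>c = N (N - 1) e\<close> for a unit vector \<open>e\<close>, so that the barycenter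
  is \<open>0\<close>. Translates have zero deficit, and mixing raises the deficit by at most the entropy
  \<open>- u log u - v log v\<close> of the weights, which tends to \<open>0\<close>. The mass \<open>1 / N\<close> at distance
  \<open>N (N - 1)\<close> makes the first moment, and hence the Wasserstein distance, diverge.

  The lower bound on the deficit does not need the logarithmic Sobolev inequality: the entropy is
  at most \<open>(u |b|\<^sup>2 + v |c|\<^sup>2) / 2\<close> by convexity, and half the Fisher information falls short of
  this number only by half of \<open>u v |b - c|\<^sup>2\<close> times the integral of \<open>f\<^sub>b f\<^sub>c / f\<close>. By the
  inequality of arithmetic and geometric means that integral is at most
  \<open>exp (- |b - c|\<^sup>2 / 8) / (2 \<surd>(u v))\<close>.
\<close>

section \<open>Weak gradients\<close>

lemma lborel_integral_translate:
  fixes c :: "'a::euclidean_space" and g :: "'a \<Rightarrow> 'b::{banach, second_countable_topology}"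
  assumes [measurable]: "g \<in> borel_measurable borel"
  shows "(LINT x|lborel. g (c + x)) = (LINT x|lborel. g x)"
proof -
  have "(LINT x|lborel. g x) = (LINT x|distr lborel borel ((+) c). g x)"
    by (simp only: lborel_distr_plus)
  also have "\<dots> = (LINT x|lborel. g (c + x))"
    by (subst integral_distr) auto
  finally show ?thesis by simp
qed

lemma lborel_integrable_translate:
  fixes c :: "'a::euclidean_space" and g :: "'a \<Rightarrow> 'b::{banach, second_countable_topology}"
  assumes [measurable]: "integrable lborel g"
  shows "integrable lborel (\<lambda>x. g (c + x))"
proof -
  have "integrable (distr lborel borel ((+) c)) g"
    using assms by (simp only: lborel_distr_plus)
  then show ?thesis
    by (subst (asm) integrable_distr_eq) auto
qed

lemma integrable_continuous_compact_support:
  fixes g :: "'a::euclidean_space \<Rightarrow> 'b::euclidean_space"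
  assumes "continuous_on UNIV g" "compact K" "\<And>x. x \<notin> K \<Longrightarrow> g x = 0"
  shows "integrable lborel g"
proof -
  have "integrable lborel (\<lambda>x. indicator K x *\<^sub>R g x)"
    using assms by (intro borel_integrable_compact) (auto intro: continuous_on_subset)
  also have "(\<lambda>x. indicator K x *\<^sub>R g x) = g"
    using assms(3) by (auto simp: indicator_def)
  finally show ?thesis .
qed

lemma GDERIV_continuous_on:
  assumes "\<And>x. GDERIV g x :> D x"
  shows "continuous_on S g"
proof (intro continuous_at_imp_continuous_on ballI)
  show "isCont g x" for x
    using assms[of x] unfolding gderiv_def by (rule has_derivative_continuous)
qed

lemma GDERIV_unique:
  assumes "GDERIV g x :> D" "GDERIV g x :> D'"
  shows "D = D'"
proof -
  have "(\<lambda>h. h \<bullet> D) = (\<lambda>h. h \<bullet> D')"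
    using assms has_derivative_unique unfolding gderiv_def by blast
  then show ?thesis
    by (metis inner_commute vector_eq_ldot)
qed

text \<open>Near such a point \<open>g\<close> is constantly 0. Thus a gradient inherits compact
  support, which makes the integrals against it finite.\<close>

lemma GDERIV_zero_outside_support:
  assumes "GDERIV g x :> D" "x \<notin> closure {x. g x \<noteq> 0}"
  shows "D = 0"
proof -
  have "((\<lambda>_. 0) has_derivative (\<lambda>h. h \<bullet> D)) (at x)"
  proof (rule has_derivative_transform_within_open)
    show "(g has_derivative (\<lambda>h. h \<bullet> D)) (at x)"
      using assms by (simp add: gderiv_def)
    show "open (- closure {x. g x \<noteq> 0})" "x \<in> - closure {x. g x \<noteq> 0}"
      using assms by auto
    show "g y = 0" if "y \<in> - closure {x. g x \<noteq> 0}" for y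
      using that closure_subset[of "{x. g x \<noteq> 0}"] by auto
  qed
  then have "GDERIV (\<lambda>_. 0::real) x :> D"
    by (simp add: gderiv_def)
  then show ?thesis
    using GDERIV_const GDERIV_unique by blast
qed

text \<open>The difference quotients of \<open>g\<close> integrate to \<open>0\<close> by translation invariance.\<close>

lemma integral_gradient_eq_0:
  fixes g :: "'a::euclidean_space \<Rightarrow> real"
  assumes D: "\<And>x. GDERIV g x :> D x" and cont: "continuous_on UNIV D"
    and cpt: "compact (closure {x. g x \<noteq> 0})"
  shows "(LINT x|lborel. D x) = 0"
proof -
  define K where "K = closure {x. g x \<noteq> 0}"
  have gK: "g x = 0" if "x \<notin> K" for x
    using that closure_subset[of "{x. g x \<noteq> 0}"] unfolding K_def by auto
  have DK: "D x = 0" if "x \<notin> K" for x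
    using GDERIV_zero_outside_support[OF D] that unfolding K_def by blast
  have cK: "compact K" using cpt by (simp add: K_def)
  have contg: "continuous_on UNIV g"
    using D by (rule GDERIV_continuous_on)
  have intD: "integrable lborel D"
    by (rule integrable_continuous_compact_support[OF cont cK DK])
  have intg: "integrable lborel g"
    by (rule integrable_continuous_compact_support[OF contg cK gK])
  have [measurable]: "g \<in> borel_measurable borel" "D \<in> borel_measurable borel"
    using contg cont by (auto intro: borel_measurable_continuous_onI)
  \<comment> \<open>\<open>D\<close> is bounded on its compact support, so \<open>M\<close> bounds
    the gradient everywhere and, by the mean value inequality, is a Lipschitz constant of
    \<open>g\<close>.\<close>
  have "bounded (D ` K)"
    using cK cont by (intro compact_imp_bounded compact_continuous_image) (auto intro: continuous_on_subset)
  then obtain M0 where M0: "\<And>x. x \<in> K \<Longrightarrow> norm (D x) \<le> M0"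
    by (auto simp: bounded_iff)
  define M where "M = max M0 0"
  have M: "norm (D x) \<le> M" for x
    using M0 DK unfolding M_def by (cases "x \<in> K") (auto simp: le_max_iff_disj)
  have M_nonneg: "0 \<le> M" by (simp add: M_def)
  \<comment> \<open>A difference quotient with step at most 1 can be nonzero only within distance 1
    of \<open>K\<close>. Hence \<open>M\<close> times the indicator of \<open>K2\<close> dominates
    all quotients at once.\<close>
  define K2 where "K2 = {x + y | x y. x \<in> K \<and> y \<in> cball (0::'a) 1}"
  have cK2: "compact K2"
    unfolding K2_def by (intro compact_sums cK) auto
  have inner_0: "(LINT x|lborel. D x) \<bullet> b = 0" if b: "b \<in> Basis" for b
  proof -
    define h where "h m = 1 / real (Suc m)" for m
    define s where "s m x = (g (h m *\<^sub>R b + x) - g x) / h m" for m x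
    have hpos: "h m > 0" "h m \<le> 1" for m
      by (auto simp: h_def)
    have [measurable]: "s m \<in> borel_measurable borel" for m
      unfolding s_def by measurable
    have "(\<lambda>m. LINT x|lborel. s m x) \<longlonglongrightarrow> (LINT x|lborel. D x \<bullet> b)"
    proof (rule integral_dominated_convergence)
      show "integrable lborel (\<lambda>x. indicator K2 x *\<^sub>R M)"
        by (intro borel_integrable_compact cK2) auto
      show "AE x in lborel. (\<lambda>m. s m x) \<longlonglongrightarrow> D x \<bullet> b"
      proof (intro always_eventually allI)
        fix x
        have "((\<lambda>t. g (t *\<^sub>R b + x)) has_derivative (\<lambda>t. (t *\<^sub>R b) \<bullet> D x)) (at 0)"
        proof -
          have 1: "((\<lambda>t. t *\<^sub>R b + x) has_derivative (\<lambda>t. t *\<^sub>R b)) (at 0)"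
            by (auto intro!: derivative_eq_intros)
          show ?thesis
            using has_derivative_compose[OF 1, of g "\<lambda>h. h \<bullet> D x"] D[of x]
            by (simp add: gderiv_def)
        qed
        then have "((\<lambda>t. g (t *\<^sub>R b + x)) has_real_derivative D x \<bullet> b) (at 0)"
          by (simp add: has_field_derivative_def inner_commute mult_commute_abs)
        then have "((\<lambda>t. (g (t *\<^sub>R b + x) - g x) / t) \<longlongrightarrow> D x \<bullet> b) (at 0)"
          by (simp add: DERIV_def)
        moreover have "filterlim h (at 0) sequentially"
        proof (rule filterlim_atI)
          show "h \<longlonglongrightarrow> 0"
            unfolding h_def by (rule LIMSEQ_Suc[OF lim_1_over_n])
          show "\<forall>\<^sub>F x in sequentially. h x \<noteq> 0"
            using hpos by (simp add: less_imp_neq[symmetric])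
        qed
        ultimately show "(\<lambda>m. s m x) \<longlonglongrightarrow> D x \<bullet> b"
          unfolding s_def by (rule filterlim_compose)
      qed
      show "AE x in lborel. norm (s m x) \<le> indicator K2 x *\<^sub>R M" for m
      proof (intro always_eventually allI)
        fix x
        show "norm (s m x) \<le> indicator K2 x *\<^sub>R M"
        proof (cases "x \<in> K2")
          case True
          have "norm (g (h m *\<^sub>R b + x) - g x) \<le> M * norm (h m *\<^sub>R b + x - x)"
          proof (rule differentiable_bound[of UNIV])
            show "(g has_derivative (\<lambda>h. h \<bullet> D y)) (at y within UNIV)" for y
              using D by (simp add: gderiv_def)
            show "onorm (\<lambda>h. h \<bullet> D y) \<le> M" for y
            proof (rule onorm_bound[OF M_nonneg])
              show "norm (z \<bullet> D y) \<le> M * norm z" for z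
                using Cauchy_Schwarz_ineq2[of z "D y"] M[of y]
                by (metis mult.commute mult_left_mono norm_ge_zero order_trans real_norm_def)
            qed
          qed auto
          also have "\<dots> = M * h m"
            using b hpos(1)[of m] by (simp add: less_imp_le)
          finally show ?thesis
            using hpos(1)[of m] True by (simp add: s_def divide_le_eq)
        next
          case False
          have "x \<notin> K"
          proof
            assume "x \<in> K"
            then have "x + 0 \<in> K2" unfolding K2_def by force
            with False show False by simp
          qed
          moreover have "h m *\<^sub>R b + x \<notin> K"
          proof
            assume *: "h m *\<^sub>R b + x \<in> K"
            have "norm (- (h m *\<^sub>R b)) \<le> 1" using b hpos[of m] by simp
            then have "(h m *\<^sub>R b + x) + (- (h m *\<^sub>R b)) \<in> K2"
              unfolding K2_def using * by (metis (mono_tags, lifting) mem_Collect_eq mem_cball_0)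
            with False show False by simp
          qed
          ultimately show ?thesis
            using gK False by (simp add: s_def)
        qed
      qed
    qed measurable
    moreover have "(LINT x|lborel. s m x) = 0" for m
      unfolding s_def
      using lborel_integral_translate[of g "h m *\<^sub>R b"] intg lborel_integrable_translate[OF intg]
      by (subst Bochner_Integration.integral_divide_zero, subst Bochner_Integration.integral_diff) auto
    ultimately have "(LINT x|lborel. D x \<bullet> b) = 0"
      by (simp add: LIMSEQ_const_iff)
    then show ?thesis
      using intD by simp
  qed
  show ?thesis
    by (rule euclidean_eqI) (simp add: inner_0)
qed

lemma locally_integrable_continuous:
  "continuous_on UNIV f \<Longrightarrow> locally_integrable f"
  unfolding locally_integrable_def set_integrable_def
  by (intro allI impI borel_integrable_compact) (auto intro: continuous_on_subset)

text \<open>The product of \<open>f\<close> with a test function is of class C^1 with compact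
  support, so its gradient integrates to 0. By the product rule this is the defining identity of the
  weak gradient.\<close>

lemma is_weak_gradient_GDERIV:
  assumes f: "\<And>x. GDERIV f x :> G x" and G: "continuous_on UNIV G"
  shows "is_weak_gradient f G"
proof -
  have contf: "continuous_on UNIV f"
    using f by (rule GDERIV_continuous_on)
  show ?thesis
    unfolding is_weak_gradient_def
  proof (intro conjI allI impI locally_integrable_continuous contf G; elim conjE)
    fix \<phi> :: "real ^ 'a \<Rightarrow> real" and D
    assume \<phi>: "\<forall>x. GDERIV \<phi> x :> D x" "continuous_on UNIV D" "compact (closure {x. \<phi> x \<noteq> 0})"
    have cont\<phi>: "continuous_on UNIV \<phi>"
      using \<phi>(1) by (intro GDERIV_continuous_on) auto
    have \<phi>K: "\<phi> x = 0" if "x \<notin> closure {x. \<phi> x \<noteq> 0}" for x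
      using that closure_subset[of "{x. \<phi> x \<noteq> 0}"] by auto
    have DK: "D x = 0" if "x \<notin> closure {x. \<phi> x \<noteq> 0}" for x
      using GDERIV_zero_outside_support[of \<phi> x "D x"] \<phi>(1) that by blast
    have int: "integrable lborel (\<lambda>x. f x *\<^sub>R D x)" "integrable lborel (\<lambda>x. \<phi> x *\<^sub>R G x)"
      using \<phi>K DK
      by (blast intro!: integrable_continuous_compact_support[OF _ \<phi>(3)]
          continuous_on_scaleR contf cont\<phi> G \<phi>(2) scaleR_eq_0_iff[THEN iffD2])+
    have "(LINT x|lborel. f x *\<^sub>R D x + \<phi> x *\<^sub>R G x) = 0"
    proof (rule integral_gradient_eq_0)
      show "GDERIV (\<lambda>x. f x * \<phi> x) x :> f x *\<^sub>R D x + \<phi> x *\<^sub>R G x" for x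
        using f \<phi>(1) by (intro GDERIV_mult) auto
      show "continuous_on UNIV (\<lambda>x. f x *\<^sub>R D x + \<phi> x *\<^sub>R G x)"
        by (intro continuous_intros contf cont\<phi> G \<phi>)
      have "closure {x. f x * \<phi> x \<noteq> 0} \<subseteq> closure {x. \<phi> x \<noteq> 0}"
        by (intro closure_mono) auto
      then show "compact (closure {x. f x * \<phi> x \<noteq> 0})"
        using \<phi>(3) bounded_subset closed_closure unfolding compact_eq_bounded_closed by blast
    qed
    then show "(LINT x|lborel. f x *\<^sub>R D x) = - (LINT x|lborel. \<phi> x *\<^sub>R G x)"
      using int by (simp add: add_eq_0_iff)
  qed
qed

section \<open>The fundamental lemma of the calculus of variations\<close>

text \<open>By the Lindelof property, countably many of the balls contained in \<open>U\<close>
  cover it. As \<open>U\<close> is nonempty, they can be enumerated by all natural numbers, possibly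
  with repetition.\<close>

lemma open_eq_Union_balls:
  fixes U :: "'a::euclidean_space set"
  assumes "open U" "U \<noteq> {}"
  obtains c :: "nat \<Rightarrow> 'a" and r where "\<And>n. 0 < r n" "U = (\<Union>n. ball (c n) (r n))"
proof -
  define F where "F = {ball x e | x e. 0 < e \<and> ball x e \<subseteq> U}"
  have UF: "\<Union>F = U"
  proof
    show "U \<subseteq> \<Union>F"
    proof
      fix x assume "x \<in> U"
      then obtain e where "0 < e" "ball x e \<subseteq> U"
        using assms(1) by (meson openE)
      then have "ball x e \<in> F" "x \<in> ball x e" unfolding F_def by auto
      then show "x \<in> \<Union>F" by blast
    qed
  qed (auto simp: F_def)
  have "\<And>S. S \<in> F \<Longrightarrow> open S" by (auto simp: F_def)
  then obtain F' where F': "F' \<subseteq> F" "countable F'" "\<Union>F' = \<Union>F"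
    using Lindelof[of F] by blast
  have ne: "F' \<noteq> {}" using F'(3) UF assms(2) by auto
  have "\<exists>x e. 0 < e \<and> from_nat_into F' n = ball x e" for n
  proof -
    have "from_nat_into F' n \<in> F"
      using from_nat_into[OF ne, of n] F'(1) by blast
    then show ?thesis unfolding F_def by blast
  qed
  then obtain c r where cr: "\<And>n. 0 < r n" "\<And>n. from_nat_into F' n = ball (c n) (r n)"
    by metis
  have "U = (\<Union>n. ball (c n) (r n))"
    using F' UF range_from_nat_into[OF ne F'(2)] cr(2) by auto
  with cr(1) show ?thesis by (rule that)
qed

text \<open>Squaring removes the kink of the positive part: at 0 the difference quotient is at most
  \<open>\<bar>h\<bar>\<close>. This is the C^1 profile of the bump functions below.\<close>

lemma has_real_derivative_max_0_squared:
  "((\<lambda>s::real. (max 0 s)\<^sup>2) has_real_derivative 2 * max 0 s) (at s)"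
proof -
  consider "s < 0" | "s = 0" | "s > 0" by linarith
  then show ?thesis
  proof cases
    case 1
    have "((\<lambda>s::real. 0) has_real_derivative 0) (at s)" by simp
    then have "((\<lambda>s::real. (max 0 s)\<^sup>2) has_real_derivative 0) (at s)"
      by (rule has_field_derivative_transform_within_open[of _ _ _ "{..<0}"]) (use 1 in auto)
    then show ?thesis using 1 by simp
  next
    case 3
    have "((\<lambda>s::real. s\<^sup>2) has_real_derivative 2 * s) (at s)"
      by (auto intro!: derivative_eq_intros)
    then have "((\<lambda>s::real. (max 0 s)\<^sup>2) has_real_derivative 2 * s) (at s)"
      by (rule has_field_derivative_transform_within_open[of _ _ _ "{0<..}"]) (use 3 in auto)
    then show ?thesis using 3 by simp
  next
    case 2
    have "((\<lambda>h::real. (max 0 h)\<^sup>2 / h) \<longlongrightarrow> 0) (at 0)"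
    proof (rule Lim_null_comparison)
      show "\<forall>\<^sub>F h in at 0. norm ((max 0 h)\<^sup>2 / h) \<le> \<bar>h::real\<bar>"
        by (intro always_eventually allI) (auto simp: max_def power2_eq_square)
      show "((\<lambda>h::real. \<bar>h\<bar>) \<longlongrightarrow> 0) (at 0)"
        by (intro tendsto_eq_intros) auto
    qed
    then show ?thesis using 2 by (simp add: DERIV_def)
  qed
qed

lemma GDERIV_sum:
  assumes "\<And>i. i \<in> I \<Longrightarrow> GDERIV (f i) x :> D i"
  shows "GDERIV (\<lambda>x. \<Sum>i\<in>I. f i x) x :> (\<Sum>i\<in>I. D i)"
  using assms unfolding gderiv_def inner_sum_right by (rule has_derivative_sum)

text \<open>The indicator of \<open>U\<close> is the limit of the test functions \<open>1 - exp (- P m)\<close>, where \<open>P m\<close> is a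
  sum of squared bumps positive on the first \<open>m\<close> balls of a cover of \<open>U\<close>.\<close>

lemma integral_open_eq_0_if_test_integrals_eq_0:
  fixes h :: "'a::euclidean_space \<Rightarrow> real"
  assumes int: "\<And>K. compact K \<Longrightarrow> set_integrable lborel K h"
    and test: "\<And>\<phi> D. (\<And>x. GDERIV \<phi> x :> D x) \<Longrightarrow> continuous_on UNIV D \<Longrightarrow>
      compact (closure {x. \<phi> x \<noteq> 0}) \<Longrightarrow> (LINT x|lborel. \<phi> x * h x) = 0"
    and U: "open U" "bounded U"
  shows "(LINT x|lborel. indicator U x * h x) = 0"
proof (cases "U = {}")
  case False
  obtain c r where cr: "\<And>n::nat. 0 < r n" "U = (\<Union>n. ball (c n) (r n))"
    using open_eq_Union_balls[OF U(1) False] by metis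
  define q where "q n x = (max 0 ((r n)\<^sup>2 - (norm (x - c n))\<^sup>2))\<^sup>2" for n x
  define q' where "q' n x = (2 * max 0 ((r n)\<^sup>2 - (norm (x - c n))\<^sup>2)) *\<^sub>R ((-2) *\<^sub>R (x - c n))"
    for n x
  have q': "GDERIV (q n) x :> q' n x" for n x
  proof -
    have "GDERIV (\<lambda>x. (r n)\<^sup>2 - (norm (x - c n))\<^sup>2) x :> (-2) *\<^sub>R (x - c n)"
      unfolding gderiv_def power2_norm_eq_inner
      by (auto intro!: derivative_eq_intros simp: inner_commute)
    from GDERIV_DERIV_compose[OF this has_real_derivative_max_0_squared]
    show ?thesis unfolding q_def q'_def .
  qed
  have q_nonneg: "0 \<le> q n x" for n x by (simp add: q_def)
  have q_pos: "0 < q n x \<longleftrightarrow> x \<in> ball (c n) (r n)" for n x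
  proof -
    have "0 < q n x \<longleftrightarrow> (norm (x - c n))\<^sup>2 < (r n)\<^sup>2"
      by (auto simp: q_def max_def)
    also have "\<dots> \<longleftrightarrow> norm (x - c n) < r n"
      using cr(1)[of n] by (metis abs_le_square_iff abs_norm_cancel abs_of_pos not_le)
    finally show ?thesis by (simp add: dist_norm norm_minus_commute)
  qed
  \<comment> \<open>The factor \<open>m\<close> drives \<open>P m x\<close> to infinity at every
    point of \<open>U\<close>, even if the sum of the bumps stays bounded there.\<close>
  define P where "P m x = real m * (\<Sum>n<m. q n x)" for m x
  define P' where "P' m x = real m *\<^sub>R (\<Sum>n<m. q' n x)" for m x
  define \<phi> where "\<phi> m x = 1 - exp (- P m x)" for m x
  define \<phi>' where "\<phi>' m x = exp (- P m x) *\<^sub>R P' m x" for m x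
  have P': "GDERIV (P m) x :> P' m x" for m x
  proof -
    have "GDERIV (\<lambda>x. real m * (\<Sum>n<m. q n x)) x :>
        real m *\<^sub>R (\<Sum>n<m. q' n x) + (\<Sum>n<m. q n x) *\<^sub>R 0"
      by (intro GDERIV_mult GDERIV_const GDERIV_sum q')
    then show ?thesis by (simp add: P_def[abs_def] P'_def)
  qed
  have \<phi>': "GDERIV (\<phi> m) x :> \<phi>' m x" for m x
  proof -
    have "((\<lambda>s. 1 - exp (- s)) has_real_derivative exp (- P m x)) (at (P m x))"
      by (auto intro!: derivative_eq_intros)
    from GDERIV_DERIV_compose[OF P' this] show ?thesis
      unfolding \<phi>_def[abs_def] \<phi>'_def .
  qed
  have P_nonneg: "0 \<le> P m x" for m x
    by (auto simp: P_def intro!: mult_nonneg_nonneg sum_nonneg q_nonneg)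
  have P_zero: "P m x = 0" if "x \<notin> U" for m x
  proof -
    have "q n x = 0" for n
      using that q_pos[of n x] q_nonneg[of n x] cr(2) by auto
    then show ?thesis by (simp add: P_def)
  qed
  have cont_q': "continuous_on UNIV (q' n)" for n
    unfolding q'_def by (intro continuous_intros)
  have cont_P: "continuous_on UNIV (P m)" for m
    using P' by (rule GDERIV_continuous_on)
  have cont: "continuous_on UNIV (\<phi>' m)" for m
    unfolding \<phi>'_def P'_def by (intro continuous_intros cont_P cont_q')
  have zero: "(LINT x|lborel. \<phi> m x * h x) = 0" for m
  proof (rule test[OF \<phi>' cont])
    have "closure {x. \<phi> m x \<noteq> 0} \<subseteq> closure U"
      using P_zero by (intro closure_mono) (auto simp: \<phi>_def)
    then show "compact (closure {x. \<phi> m x \<noteq> 0})"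
      using U(2) by (meson bounded_closure bounded_subset closed_closure compact_eq_bounded_closed)
  qed
  have [measurable]: "\<phi> m \<in> borel_measurable borel" for m
    using \<phi>' GDERIV_continuous_on[of "\<phi> m"] borel_measurable_continuous_onI by blast
  have [measurable]: "U \<in> sets borel" using U by simp
  \<comment> \<open>Only local integrability is given, so measurability comes from the restrictions
    of \<open>h\<close> to growing balls.\<close>
  have "h \<in> borel_measurable lborel"
  proof (rule borel_measurable_LIMSEQ_real)
    show "(\<lambda>x. indicator (cball 0 (real m)) x * h x) \<in> borel_measurable lborel" for m
      using int[of "cball 0 (real m)"]
      by (auto simp: set_integrable_def dest: borel_measurable_integrable)
    show "(\<lambda>m. indicator (cball 0 (real m)) x * h x) \<longlonglongrightarrow> h x" for x :: 'a
    proof (rule tendsto_eventually)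
      show "\<forall>\<^sub>F m in sequentially. indicator (cball 0 (real m)) x * h x = h x"
        using eventually_ge_at_top[of "nat \<lceil>norm x\<rceil>"]
      proof eventually_elim
        case (elim m)
        then have "norm x \<le> real m" by linarith
        then show ?case by simp
      qed
    qed
  qed
  then have [measurable]: "h \<in> borel_measurable borel" by simp
  have intU: "integrable lborel (\<lambda>x. indicator U x * h x)"
    using set_integrable_subset[OF int[of "closure U"], of U] U closure_subset[of U]
    by (simp add: set_integrable_def compact_eq_bounded_closed bounded_closure)
  have "(\<lambda>m. LINT x|lborel. \<phi> m x * h x) \<longlonglongrightarrow> (LINT x|lborel. indicator U x * h x)"
  proof (rule integral_dominated_convergence)
    show "integrable lborel (\<lambda>x. norm (indicator U x * h x))"
      using intU by (rule integrable_norm)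
    show "AE x in lborel. (\<lambda>m. \<phi> m x * h x) \<longlonglongrightarrow> indicator U x * h x"
    proof (intro always_eventually allI tendsto_mult tendsto_const)
      fix x
      show "(\<lambda>m. \<phi> m x) \<longlonglongrightarrow> indicator U x"
      proof (cases "x \<in> U")
        case True
        then obtain n where n: "0 < q n x" using cr(2) q_pos by blast
        have "filterlim (\<lambda>m. real m * q n x) at_top sequentially"
          by (rule filterlim_at_top_mult_tendsto_pos[OF tendsto_const n filterlim_real_sequentially])
        then have "filterlim (\<lambda>m. P m x) at_top sequentially"
        proof (rule filterlim_at_top_mono)
          show "\<forall>\<^sub>F m in sequentially. real m * q n x \<le> P m x"
            using eventually_gt_at_top[of n]
          proof eventually_elim
            case (elim m)
            have "q n x \<le> (\<Sum>n<m. q n x)"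
              using elim by (intro member_le_sum q_nonneg) auto
            then show ?case unfolding P_def by (intro mult_left_mono) auto
          qed
        qed
        then have "(\<lambda>m. exp (- P m x)) \<longlonglongrightarrow> 0"
          by (intro filterlim_compose[OF exp_at_bot] filterlim_compose[OF filterlim_uminus_at_bot_at_top])
        from tendsto_diff[OF tendsto_const[of 1] this] True show ?thesis
          by (simp add: \<phi>_def)
      qed (use P_zero in \<open>simp add: \<phi>_def\<close>)
    qed
    show "AE x in lborel. norm (\<phi> m x * h x) \<le> norm (indicator U x * h x)" for m
    proof (intro always_eventually allI)
      fix x
      show "norm (\<phi> m x * h x) \<le> norm (indicator U x * h x)"
      proof (cases "x \<in> U")
        case True
        have "\<bar>\<phi> m x\<bar> \<le> 1" using P_nonneg[of m x] by (simp add: \<phi>_def)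
        then show ?thesis using True by (simp add: abs_mult mult_left_le_one_le)
      qed (use P_zero in \<open>simp add: \<phi>_def\<close>)
    qed
  qed measurable
  then show ?thesis using zero by (simp add: LIMSEQ_const_iff)
qed simp

text \<open>The measures whose densities are the positive and the negative part of \<open>h\<close>
  agree on open sets, an intersection-stable generator of the Borel sets, and therefore coincide. So
  the two parts agree almost everywhere, and at each point at most one of them is nonzero.\<close>

lemma AE_eq_0_if_open_integrals_eq_0:
  fixes h :: "'a::euclidean_space \<Rightarrow> real"
  assumes h: "integrable lborel h"
    and zero: "\<And>U. open U \<Longrightarrow> (LINT x|lborel. indicator U x * h x) = 0"
  shows "AE x in lborel. h x = 0"
proof -
  have [measurable]: "h \<in> borel_measurable borel"
    using borel_measurable_integrable[OF h] by simp
  \<comment> \<open>\<open>ennreal\<close> sends negative reals to 0, so these densities are the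
    positive and the negative part of \<open>h\<close>.\<close>
  define M1 where "M1 = density lborel (\<lambda>x. ennreal (h x))"
  define M2 where "M2 = density lborel (\<lambda>x. ennreal (- h x))"
  have fin: "(\<integral>\<^sup>+ x. ennreal (h x) \<partial>lborel) < \<infinity>" "(\<integral>\<^sup>+ x. ennreal (- h x) \<partial>lborel) < \<infinity>"
    using h integrable_minus[OF h] by (auto simp: real_integrable_def top.not_eq_extremum)
  have "M1 = M2"
  proof (rule measure_eqI_generator_eq[where E="{U. open U}" and A="\<lambda>_. UNIV" and \<Omega>=UNIV])
    show "Int_stable {U::'a set. open U}" by (auto simp: Int_stable_def)
    fix U :: "'a set" assume "U \<in> {U. open U}"
    then have [measurable]: "open U" "U \<in> sets borel" by auto
    have intU: "integrable lborel (\<lambda>x. indicator U x * h x)"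
      using integrable_mult_indicator[OF _ h, of U] by simp
    have e: "emeasure M1 U = (\<integral>\<^sup>+ x. ennreal (indicator U x * h x) \<partial>lborel)"
      "emeasure M2 U = (\<integral>\<^sup>+ x. ennreal (- (indicator U x * h x)) \<partial>lborel)"
      unfolding M1_def M2_def
      by (auto simp: emeasure_density intro!: nn_integral_cong split: split_indicator)
    have f: "emeasure M1 U < \<infinity>" "emeasure M2 U < \<infinity>"
      unfolding e using intU by (auto simp: real_integrable_def top.not_eq_extremum)
    have "enn2real (emeasure M1 U) = enn2real (emeasure M2 U)"
      using real_lebesgue_integral_def[OF intU] zero[OF \<open>open U\<close>] unfolding e by simp
    then show "emeasure M1 U = emeasure M2 U"
      using f by (metis ennreal_enn2real infinity_ennreal_def)
  next
    show "emeasure M1 UNIV \<noteq> \<infinity>"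
      using fin by (simp add: M1_def emeasure_density)
  qed (auto simp: M1_def M2_def borel_def)
  then have "AE x in lborel. ennreal (h x) = ennreal (- h x)"
    unfolding M1_def M2_def using fin
    by (subst finite_density_unique[symmetric]) (auto simp: less_top)
  then show ?thesis
  proof eventually_elim
    case (elim x)
    then show ?case
      by (cases "h x \<ge> 0") (auto simp: ennreal_neg dest: sym)
  qed
qed

text \<open>Restriction to a ball makes \<open>h\<close> integrable and every open set bounded, so
  the two preceding lemmas apply; countably many balls exhaust the space.\<close>

lemma AE_eq_0_if_test_integrals_eq_0:
  fixes h :: "'a::euclidean_space \<Rightarrow> real"
  assumes int: "\<And>K. compact K \<Longrightarrow> set_integrable lborel K h"
    and test: "\<And>\<phi> D. (\<And>x. GDERIV \<phi> x :> D x) \<Longrightarrow> continuous_on UNIV D \<Longrightarrow>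
      compact (closure {x. \<phi> x \<noteq> 0}) \<Longrightarrow> (LINT x|lborel. \<phi> x * h x) = 0"
  shows "AE x in lborel. h x = 0"
proof -
  have "AE x in lborel. indicator (ball 0 (real N)) x * h x = 0" for N
  proof (rule AE_eq_0_if_open_integrals_eq_0)
    show "integrable lborel (\<lambda>x. indicator (ball 0 (real N)) x * h x)"
      using set_integrable_subset[OF int[of "cball 0 (real N)"], of "ball 0 (real N)"]
      by (simp add: set_integrable_def)
    fix U :: "'a set" assume "open U"
    then have "(LINT x|lborel. indicator (U \<inter> ball 0 (real N)) x * h x) = 0"
      by (intro integral_open_eq_0_if_test_integrals_eq_0[OF int test])
        (auto intro: bounded_Int)
    then show "(LINT x|lborel. indicator U x * (indicator (ball 0 (real N)) x * h x)) = 0"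
      by (simp add: indicator_inter_arith mult.assoc)
  qed
  then have "AE x in lborel. \<forall>N. indicator (ball 0 (real N)) x * h x = 0"
    by (rule AE_all_countable[THEN iffD2, rule_format])
  then show ?thesis
  proof eventually_elim
    case (elim x)
    obtain N where "norm x < real N" using reals_Archimedean2 by blast
    then show ?case using elim[rule_format, of N] by simp
  qed
qed

section \<open>Uniqueness of the weak gradient and the Fisher information of C^1 densities\<close>

text \<open>Two weak gradients have equal integrals against every test function, so the fundamental
  lemma applies to each of the finitely many coordinates of their difference.\<close>

lemma is_weak_gradient_AE_unique:
  fixes f :: "real ^ 'n \<Rightarrow> real"
  assumes G: "is_weak_gradient f G" and G': "is_weak_gradient f G'"
  shows "AE x in lborel. G x = G' x"
proof -
  have "AE x in lborel. (G x - G' x) \<bullet> b = 0" for b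
  proof (rule AE_eq_0_if_test_integrals_eq_0)
    have loc: "set_integrable lborel K G" "set_integrable lborel K G'" if "compact K" for K
      using that G G' by (auto simp: is_weak_gradient_def locally_integrable_def)
    fix K :: "(real ^ 'n) set" assume "compact K"
    then have "integrable lborel (\<lambda>x. (indicator K x *\<^sub>R G x - indicator K x *\<^sub>R G' x) \<bullet> b)"
      using loc[of K] unfolding set_integrable_def
      by (intro integrable_inner_left Bochner_Integration.integrable_diff) auto
    then show "set_integrable lborel K (\<lambda>x. (G x - G' x) \<bullet> b)"
      by (simp add: set_integrable_def inner_diff_left algebra_simps)
  next
    fix \<phi> :: "real ^ 'n \<Rightarrow> real" and D
    assume \<phi>: "\<And>x. GDERIV \<phi> x :> D x" "continuous_on UNIV D" "compact (closure {x. \<phi> x \<noteq> 0})"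
    have cont\<phi>: "continuous_on UNIV \<phi>" using \<phi>(1) by (rule GDERIV_continuous_on)
    have int: "integrable lborel (\<lambda>x. \<phi> x *\<^sub>R F x)" if "locally_integrable F" for F :: "real^'n \<Rightarrow> real^'n"
    proof -
      define K where "K = closure {x. \<phi> x \<noteq> 0}"
      have K: "compact K" "\<And>x. x \<notin> K \<Longrightarrow> \<phi> x = 0"
        using \<phi>(3) closure_subset[of "{x. \<phi> x \<noteq> 0}"] unfolding K_def by auto
      have "bounded (\<phi> ` K)"
        using K(1) cont\<phi> by (intro compact_imp_bounded compact_continuous_image) (auto intro: continuous_on_subset)
      then obtain M where M: "\<And>x. x \<in> K \<Longrightarrow> \<bar>\<phi> x\<bar> \<le> M"
        by (auto simp: bounded_iff)
      have iK: "integrable lborel (\<lambda>x. indicator K x *\<^sub>R F x)"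
        using that K(1) by (auto simp: locally_integrable_def set_integrable_def)
      have [measurable]: "\<phi> \<in> borel_measurable borel"
        using cont\<phi> by (rule borel_measurable_continuous_onI)
      have *: "(\<lambda>x. \<phi> x *\<^sub>R F x) = (\<lambda>x. \<phi> x *\<^sub>R (indicator K x *\<^sub>R F x))"
      proof
        show "\<phi> x *\<^sub>R F x = \<phi> x *\<^sub>R (indicator K x *\<^sub>R F x)" for x
          using K(2)[of x] by (cases "x \<in> K") auto
      qed
      have [measurable]: "(\<lambda>x. indicator K x *\<^sub>R F x) \<in> borel_measurable lborel"
        using iK by (rule borel_measurable_integrable)
      show ?thesis unfolding *
      proof (rule Bochner_Integration.integrable_bound)
        show "integrable lborel (\<lambda>x. M *\<^sub>R norm (indicator K x *\<^sub>R F x))"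
          using iK by (intro integrable_scaleR_right integrable_norm)
        show "(\<lambda>x. \<phi> x *\<^sub>R (indicator K x *\<^sub>R F x)) \<in> borel_measurable lborel"
          by measurable
        show "AE x in lborel. norm (\<phi> x *\<^sub>R (indicator K x *\<^sub>R F x))
            \<le> norm (M *\<^sub>R norm (indicator K x *\<^sub>R F x))"
        proof (intro always_eventually allI)
          fix x
          show "norm (\<phi> x *\<^sub>R (indicator K x *\<^sub>R F x)) \<le> norm (M *\<^sub>R norm (indicator K x *\<^sub>R F x))"
            using M[of x] by (cases "x \<in> K") (auto simp: abs_mult intro!: mult_right_mono)
        qed
      qed
    qed
    have "(LINT x|lborel. \<phi> x *\<^sub>R G x) = (LINT x|lborel. \<phi> x *\<^sub>R G' x)"
    proof -
      have "(LINT x|lborel. f x *\<^sub>R D x) = - (LINT x|lborel. \<phi> x *\<^sub>R G x)"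
        "(LINT x|lborel. f x *\<^sub>R D x) = - (LINT x|lborel. \<phi> x *\<^sub>R G' x)"
        using G G' \<phi> unfolding is_weak_gradient_def by blast+
      then show ?thesis by simp
    qed
    moreover have i: "integrable lborel (\<lambda>x. \<phi> x *\<^sub>R G x)" "integrable lborel (\<lambda>x. \<phi> x *\<^sub>R G' x)"
      using int G G' by (auto simp: is_weak_gradient_def)
    ultimately have "(LINT x|lborel. (\<phi> x *\<^sub>R G x - \<phi> x *\<^sub>R G' x) \<bullet> b) = 0"
      by (subst integral_inner_left) (auto simp: Bochner_Integration.integral_diff)
    then show "(LINT x|lborel. \<phi> x * ((G x - G' x) \<bullet> b)) = 0"
      by (simp add: inner_diff_left right_diff_distrib)
  qed
  then have "AE x in lborel. \<forall>b\<in>Basis. (G x - G' x) \<bullet> b = 0"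
    by (intro AE_finite_allI) auto
  then show ?thesis
  proof eventually_elim
    case (elim x)
    have "G x - G' x = 0" by (rule euclidean_eqI) (simp add: elim)
    then show ?case by simp
  qed
qed

text \<open>The classical gradient is a weak one, so the gradient picked by \<open>SOME\<close>
  agrees with it Lebesgue-almost everywhere, hence also almost everywhere for the Gaussian, which
  has a density.\<close>

lemma fisher_information_eq:
  assumes "\<And>x. GDERIV f x :> G x" "continuous_on UNIV G"
  shows "fisher_information f = (\<integral>\<^sup>+ x. ennreal ((norm (G x))\<^sup>2 / f x) \<partial>std_gaussian)"
proof -
  have G: "is_weak_gradient f G"
    using assms by (rule is_weak_gradient_GDERIV)
  then have some: "is_weak_gradient f (SOME G. is_weak_gradient f G)"
    by (rule someI[of "is_weak_gradient f"])
  have "AE x in lborel. (SOME G. is_weak_gradient f G) x = G x"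
    by (rule is_weak_gradient_AE_unique[OF some G])
  then have "AE x in std_gaussian. (SOME G. is_weak_gradient f G) x = G x"
    unfolding std_gaussian_def by (subst AE_density) (auto elim: eventually_mono)
  then have "(\<integral>\<^sup>+ x. ennreal ((norm ((SOME G. is_weak_gradient f G) x))\<^sup>2 / f x) \<partial>std_gaussian)
      = (\<integral>\<^sup>+ x. ennreal ((norm (G x))\<^sup>2 / f x) \<partial>std_gaussian)"
    by (intro nn_integral_cong_AE) (auto elim: eventually_mono)
  then show ?thesis
    using G unfolding fisher_information_def by auto
qed

section \<open>The standard Gaussian and its translates\<close>

lemma prod_normal_density_Basis:
  fixes x :: "'a::euclidean_space"
  shows "(\<Prod>b\<in>Basis. normal_density 0 \<sigma> (x \<bullet> b)) =
    (1 / sqrt (2 * pi * \<sigma>\<^sup>2)) ^ DIM('a) * exp (- (norm x)\<^sup>2 / (2 * \<sigma>\<^sup>2))"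
proof -
  have "(norm x)\<^sup>2 = (\<Sum>b\<in>Basis. (x \<bullet> b)\<^sup>2)"
    unfolding power2_norm_eq_inner by (subst euclidean_inner) (simp add: power2_eq_square)
  then have "exp (- (norm x)\<^sup>2 / (2 * \<sigma>\<^sup>2)) = (\<Prod>b\<in>Basis. exp (- (x \<bullet> b)\<^sup>2 / (2 * \<sigma>\<^sup>2)))"
    by (simp add: exp_sum sum_negf sum_divide_distrib flip: exp_sum)
  then show ?thesis
    by (simp add: normal_density_def prod.distrib power_divide prod_dividef)
qed

text \<open>The integral factorizes over the coordinates. Two values of \<open>\<sigma>\<close>
  matter: 1 normalizes \<open>std_gaussian\<close>, and \<open>sqrt 2\<close> provides the
  integrable majorant in later estimates.\<close>

lemma nn_integral_prod_normal_density:
  assumes "0 < \<sigma>"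
  shows "(\<integral>\<^sup>+ x. ennreal ((1 / sqrt (2 * pi * \<sigma>\<^sup>2)) ^ DIM('a) * exp (- (norm x)\<^sup>2 / (2 * \<sigma>\<^sup>2)))
    \<partial>(lborel :: 'a::euclidean_space measure)) = 1"
proof -
  have 1: "(\<integral>\<^sup>+ y. ennreal (normal_density 0 \<sigma> y) \<partial>lborel) = 1"
    using assms by (subst nn_integral_eq_integral)
      (auto intro: integrable_normal_density simp: integral_normal_density)
  have "(\<integral>\<^sup>+ x. ennreal ((1 / sqrt (2 * pi * \<sigma>\<^sup>2)) ^ DIM('a) * exp (- (norm x)\<^sup>2 / (2 * \<sigma>\<^sup>2)))
      \<partial>(lborel :: 'a measure))
      = (\<integral>\<^sup>+ x. (\<Prod>b\<in>Basis. ennreal (normal_density 0 \<sigma> (x \<bullet> b))) \<partial>(lborel :: 'a measure))"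
    by (simp only: prod_normal_density_Basis[symmetric] prod_ennreal normal_density_nonneg)
  also have "\<dots> = (\<Prod>b\<in>(Basis::'a set). (\<integral>\<^sup>+ y. ennreal (normal_density 0 \<sigma> y) \<partial>lborel))"
    by (rule nn_integral_lborel_prod) auto
  finally show ?thesis using 1 by simp
qed

definition gauss_density :: "real ^ 'n \<Rightarrow> real" where
  "gauss_density x = (2 * pi) powr (- real CARD('n) / 2) * exp (- (norm x)\<^sup>2 / 2)"

lemma gauss_density_nonneg: "0 \<le> gauss_density x"
  by (simp add: gauss_density_def)

lemma borel_measurable_gauss_density[measurable]: "gauss_density \<in> borel_measurable borel"
  unfolding gauss_density_def[abs_def] by measurable

lemma std_gaussian_eq: "std_gaussian = density lborel (\<lambda>x. ennreal (gauss_density x))"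
  by (simp add: std_gaussian_def gauss_density_def)

lemma sets_std_gaussian[simp, measurable_cong]: "sets std_gaussian = sets borel"
  by (simp add: std_gaussian_eq)

lemma space_std_gaussian[simp]: "space std_gaussian = UNIV"
  by (simp add: std_gaussian_eq)

lemma prob_space_std_gaussian: "prob_space (std_gaussian :: (real ^ 'n) measure)"
proof
  have "(2 * pi) powr (- real CARD('n) / 2) = ((2 * pi) powr (- 1 / 2)) ^ CARD('n)"
    by (simp add: powr_power)
  also have "(2 * pi) powr (- 1 / 2) = 1 / sqrt (2 * pi)"
    by (simp add: powr_minus powr_half_sqrt inverse_eq_divide flip: minus_divide_left)
  finally have "gauss_density x = (1 / sqrt (2 * pi * 1\<^sup>2)) ^ DIM(real^'n) * exp (- (norm x)\<^sup>2 / (2 * 1\<^sup>2))"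
    for x :: "real ^ 'n"
    by (simp add: gauss_density_def)
  then have "(\<integral>\<^sup>+ x. ennreal (gauss_density x) \<partial>(lborel :: (real ^ 'n) measure)) = 1"
    using nn_integral_prod_normal_density[of 1, where 'a="real^'n"] by simp
  then show "emeasure (std_gaussian :: (real ^ 'n) measure) (space std_gaussian) = 1"
    by (simp add: std_gaussian_eq emeasure_density)
qed

lemma measure_std_gaussian_UNIV[simp]: "measure std_gaussian UNIV = 1"
  using prob_space.prob_space[OF prob_space_std_gaussian] by simp

lemma integral_std_gaussian:
  fixes g :: "real ^ 'n \<Rightarrow> 'b::{banach, second_countable_topology}"
  assumes "g \<in> borel_measurable borel"
  shows "(LINT x|std_gaussian. g x) = (LINT x|lborel. gauss_density x *\<^sub>R g x)"
  unfolding std_gaussian_eq using assms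
  by (subst integral_density) (auto simp: gauss_density_nonneg)

lemma integrable_std_gaussian_iff:
  fixes g :: "real ^ 'n \<Rightarrow> 'b::{banach, second_countable_topology}"
  assumes "g \<in> borel_measurable borel"
  shows "integrable std_gaussian g \<longleftrightarrow> integrable lborel (\<lambda>x. gauss_density x *\<^sub>R g x)"
  unfolding std_gaussian_eq using assms
  by (subst integrable_density) (auto simp: gauss_density_nonneg)

text \<open>Half of the Gaussian exponent absorbs the exponential growth, and the other half is a
  Gaussian of variance 2. This one criterion covers all moments and all products with
  translates.\<close>

lemma integrable_std_gaussian_exp_bound:
  fixes g :: "real ^ 'n \<Rightarrow> 'b::{banach, second_countable_topology}"
  assumes [measurable]: "g \<in> borel_measurable borel"
    and bound: "\<And>x. norm (g x) \<le> C * exp (c * norm x)"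
  shows "integrable std_gaussian g"
proof -
  \<comment> \<open>The normalizing constant of the centered Gaussian of variance 2.\<close>
  define A where "A = (1 / sqrt (2 * pi * (sqrt 2)\<^sup>2)) ^ DIM(real ^ 'n)"
  have A: "0 < A" by (simp add: A_def)
  define B where "B = (2 * pi) powr (- real CARD('n) / 2)"
  have B: "0 \<le> B" by (simp add: B_def)
  have "(\<integral>\<^sup>+ x. ennreal (A * exp (- (norm x)\<^sup>2 / 4)) \<partial>(lborel :: (real ^ 'n) measure)) = 1"
    using nn_integral_prod_normal_density[of "sqrt 2", where 'a="real^'n"] by (simp add: A_def)
  then have "integrable lborel (\<lambda>x::real^'n. A * exp (- (norm x)\<^sup>2 / 4))"
    using A by (intro integrableI_nonneg) auto
  then have "integrable lborel (\<lambda>x::real^'n. (B * C * exp (c\<^sup>2) / A) * (A * exp (- (norm x)\<^sup>2 / 4)))"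
    by (rule integrable_mult_right)
  then have int: "integrable lborel (\<lambda>x::real^'n. B * C * exp (c\<^sup>2) * exp (- (norm x)\<^sup>2 / 4))"
    using A by simp
  have C: "0 \<le> C" using order_trans[OF norm_ge_zero bound[of 0]] by simp
  have "integrable lborel (\<lambda>x. gauss_density x *\<^sub>R g x)"
  proof (rule Bochner_Integration.integrable_bound[OF int])
    show "AE x in lborel. norm (gauss_density x *\<^sub>R g x)
        \<le> norm (B * C * exp (c\<^sup>2) * exp (- (norm x)\<^sup>2 / 4))"
    proof (intro always_eventually allI)
      fix x :: "real ^ 'n"
      have "0 \<le> (c - norm x / 2)\<^sup>2" by simp
      then have le: "- (norm x)\<^sup>2 / 2 + c * norm x \<le> c\<^sup>2 + - (norm x)\<^sup>2 / 4"
        by (simp add: power2_eq_square algebra_simps)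
      have "norm (gauss_density x *\<^sub>R g x) = gauss_density x * norm (g x)"
        by (simp add: gauss_density_nonneg)
      also have "\<dots> \<le> gauss_density x * (C * exp (c * norm x))"
        by (intro mult_left_mono bound gauss_density_nonneg)
      also have "\<dots> = B * C * exp (- (norm x)\<^sup>2 / 2 + c * norm x)"
        by (simp only: gauss_density_def B_def exp_add mult_ac)
      also have "\<dots> \<le> B * C * exp (c\<^sup>2 + - (norm x)\<^sup>2 / 4)"
        using le B C by (intro mult_left_mono) auto
      also have "\<dots> = B * C * exp (c\<^sup>2) * exp (- (norm x)\<^sup>2 / 4)"
        by (simp only: exp_add mult.assoc)
      finally show "norm (gauss_density x *\<^sub>R g x) \<le> norm (B * C * exp (c\<^sup>2) * exp (- (norm x)\<^sup>2 / 4))"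
        by simp
    qed
  qed measurable
  then show ?thesis by (subst integrable_std_gaussian_iff) auto
qed

text \<open>Brings moments of any order under the exponential integrability criterion; it rests on
  \<open>ln t \<le> t\<close>.\<close>

lemma powr_le_exp:
  fixes t p :: real
  assumes "0 \<le> t" "0 \<le> p"
  shows "t powr p \<le> exp (p * t)"
proof (cases "t = 0")
  case False
  then have "ln t \<le> t" using assms(1) ln_le_minus_one[of t] by simp
  then show ?thesis
    using False assms by (simp add: powr_def mult_left_mono)
qed simp

text \<open>\<open>gexp a\<close> is the density with respect to the standard Gaussian of its translate by \<open>a\<close>.\<close>

definition gexp :: "real ^ 'n \<Rightarrow> real ^ 'n \<Rightarrow> real" where
  "gexp a x = exp (a \<bullet> x - (norm a)\<^sup>2 / 2)"

lemma gexp_pos: "0 < gexp a x" and gexp_nonneg: "0 \<le> gexp a x"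
  by (simp_all add: gexp_def)

lemma ln_gexp: "ln (gexp a x) = a \<bullet> x - (norm a)\<^sup>2 / 2"
  by (simp add: gexp_def)

lemma borel_measurable_gexp[measurable]: "gexp a \<in> borel_measurable borel"
  unfolding gexp_def[abs_def] by measurable

lemma gexp_le: "gexp a x \<le> exp (norm a * norm x)"
  using norm_cauchy_schwarz[of a x] zero_le_power2[of "norm a"]
  unfolding gexp_def exp_le_cancel_iff by linarith

text \<open>Completing the square in the exponent.\<close>

lemma gauss_density_gexp: "gauss_density x * gexp a x = gauss_density (x - a)"
proof -
  have "- (norm x)\<^sup>2 / 2 + (a \<bullet> x - (norm a)\<^sup>2 / 2) = - (norm (x - a))\<^sup>2 / 2"
    by (simp add: power2_norm_eq_inner inner_diff inner_commute field_simps)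
  then show ?thesis
    unfolding gauss_density_def gexp_def by (simp only: mult.assoc exp_add[symmetric])
qed

lemma integral_gexp:
  fixes g :: "real ^ 'n \<Rightarrow> 'b::{banach, second_countable_topology}"
  assumes [measurable]: "g \<in> borel_measurable borel"
  shows "(LINT x|std_gaussian. gexp a x *\<^sub>R g x) = (LINT x|std_gaussian. g (a + x))"
proof -
  have "(LINT x|std_gaussian. gexp a x *\<^sub>R g x) = (LINT x|lborel. gauss_density (x - a) *\<^sub>R g x)"
    by (subst integral_std_gaussian) (simp_all add: gauss_density_gexp)
  also have "\<dots> = (LINT x|lborel. gauss_density ((a + x) - a) *\<^sub>R g (a + x))"
    by (rule lborel_integral_translate[symmetric]) measurable
  also have "\<dots> = (LINT x|std_gaussian. g (a + x))"
    by (subst integral_std_gaussian) simp_all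
  finally show ?thesis .
qed

lemma integrable_gexp_scaleR:
  fixes g :: "real ^ 'n \<Rightarrow> 'b::{banach, second_countable_topology}"
  assumes [measurable]: "g \<in> borel_measurable borel"
    and bound: "\<And>x. norm (g x) \<le> C * exp (c * norm x)"
  shows "integrable std_gaussian (\<lambda>x. gexp a x *\<^sub>R g x)"
proof (rule integrable_std_gaussian_exp_bound)
  fix x
  have "norm (gexp a x *\<^sub>R g x) = gexp a x * norm (g x)"
    by (simp add: gexp_nonneg)
  also have "\<dots> \<le> exp (norm a * norm x) * (C * exp (c * norm x))"
    by (intro mult_mono gexp_le bound) auto
  also have "\<dots> = C * exp ((norm a + c) * norm x)"
    by (simp add: exp_add distrib_right)
  finally show "norm (gexp a x *\<^sub>R g x) \<le> C * exp ((norm a + c) * norm x)" .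
qed measurable

lemma integrable_gexp: "integrable std_gaussian (gexp a)"
  using integrable_gexp_scaleR[of "\<lambda>_. 1::real" 1 0 a] by simp

lemma integral_gexp_1: "(LINT x|std_gaussian. gexp a x) = 1"
  using integral_gexp[of "\<lambda>_. 1::real" a] by simp

lemma le_exp: "t \<le> exp (t::real)"
  using exp_ge_add_one_self[of t] by linarith

lemma integrable_std_gaussian_id: "integrable std_gaussian (\<lambda>x::real^'n. x)"
  by (rule integrable_std_gaussian_exp_bound[of _ 1 1]) (auto intro: le_exp)

text \<open>By reflection symmetry the integral equals its own negative.\<close>

lemma integral_std_gaussian_id: "(LINT x|std_gaussian. x) = (0 :: real ^ 'n)"
proof -
  have d: "distr lborel borel uminus = (lborel :: (real ^ 'n) measure)"
    by (subst lborel_affine[of "-1" 0]) (auto simp: density_1)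
  have "(LINT x|lborel. gauss_density x *\<^sub>R x) =
      (LINT x|distr lborel borel uminus. gauss_density x *\<^sub>R (x :: real ^ 'n))"
    by (simp only: d)
  also have "\<dots> = - (LINT x|lborel. gauss_density x *\<^sub>R x)"
    by (subst integral_distr) (auto simp: gauss_density_def)
  finally have "(LINT x|std_gaussian. x) = - (LINT x|std_gaussian. x :: real ^ 'n)"
    by (simp add: integral_std_gaussian)
  then show ?thesis by (simp add: eq_neg_iff_add_eq_0 flip: scaleR_2)
qed

lemma integral_gexp_id: "(LINT x|std_gaussian. gexp a x *\<^sub>R x) = a"
proof -
  interpret finite_measure "std_gaussian :: (real ^ 'a) measure"
    by (rule prob_space.finite_measure[OF prob_space_std_gaussian])
  have "(LINT x|std_gaussian. gexp a x *\<^sub>R x) = (LINT x|std_gaussian. a + x)"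
    by (rule integral_gexp) simp
  also have "\<dots> = a"
    using integrable_std_gaussian_id
    by (subst Bochner_Integration.integral_add) (auto simp: integral_std_gaussian_id)
  finally show ?thesis .
qed

lemma integrable_gexp_id: "integrable std_gaussian (\<lambda>x. gexp a x *\<^sub>R x)"
  by (rule integrable_gexp_scaleR[of _ 1 1]) (auto intro: le_exp)

text \<open>\<open>ln (gexp a x)\<close> is affine in \<open>x\<close>, so the entropy follows from
  the mean \<open>a\<close> and the total mass 1 of the translate.\<close>

lemma integrable_gexp_ln: "integrable std_gaussian (\<lambda>x. gexp a x * ln (gexp a x))"
  and integral_gexp_ln: "(LINT x|std_gaussian. gexp a x * ln (gexp a x)) = (norm a)\<^sup>2 / 2"
proof -
  have eq: "(\<lambda>x. gexp a x * ln (gexp a x))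
      = (\<lambda>x. a \<bullet> (gexp a x *\<^sub>R x) - (norm a)\<^sup>2 / 2 * gexp a x)"
    by (auto simp: ln_gexp algebra_simps)
  have i: "integrable std_gaussian (\<lambda>x. a \<bullet> (gexp a x *\<^sub>R x))"
    "integrable std_gaussian (\<lambda>x. (norm a)\<^sup>2 / 2 * gexp a x)"
    by (intro integrable_inner_right integrable_gexp_id integrable_mult_right integrable_gexp)+
  show "integrable std_gaussian (\<lambda>x. gexp a x * ln (gexp a x))"
    unfolding eq using i by (rule Bochner_Integration.integrable_diff)
  have "(LINT x|std_gaussian. a \<bullet> (gexp a x *\<^sub>R x)) = a \<bullet> a"
    by (subst integral_inner_right[OF integrable_gexp_id]) (simp add: integral_gexp_id)
  moreover have "(LINT x|std_gaussian. (norm a)\<^sup>2 / 2 * gexp a x) = (norm a)\<^sup>2 / 2"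
    by (subst integral_mult_right_zero) (simp add: integral_gexp_1)
  ultimately show "(LINT x|std_gaussian. gexp a x * ln (gexp a x)) = (norm a)\<^sup>2 / 2"
    unfolding eq using Bochner_Integration.integral_diff[OF i]
    by (simp add: power2_norm_eq_inner)
qed

text \<open>The geometric mean of two translates is a multiple of the translate by the midpoint; the
  parallelogram identity gives the factor.\<close>

lemma sqrt_gexp_mult:
  "sqrt (gexp b x * gexp c x) = exp (- (norm (b - c))\<^sup>2 / 8) * gexp ((1/2) *\<^sub>R (b + c)) x"
proof (rule real_sqrt_unique)
  have "2 * (- (norm (b - c))\<^sup>2 / 8 + ((1/2) *\<^sub>R (b + c)) \<bullet> x - (norm ((1/2) *\<^sub>R (b + c)))\<^sup>2 / 2)
      = (b \<bullet> x - (norm b)\<^sup>2 / 2) + (c \<bullet> x - (norm c)\<^sup>2 / 2)"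
    unfolding power2_norm_eq_inner by (simp add: inner_diff inner_add inner_commute field_simps)
  then show "(exp (- (norm (b - c))\<^sup>2 / 8) * gexp ((1/2) *\<^sub>R (b + c)) x)\<^sup>2 = gexp b x * gexp c x"
    unfolding gexp_def by (simp add: exp_add[symmetric] exp_double[symmetric])
qed (simp add: gexp_nonneg)

text \<open>The Hellinger affinity of two translates of the Gaussian. Its decay in
  \<open>norm (b - c)\<close> makes their overlap negligible.\<close>

lemma sqrt_gexp_mult_integral:
  "integrable std_gaussian (\<lambda>x. sqrt (gexp b x * gexp c x))"
  "(LINT x|std_gaussian. sqrt (gexp b x * gexp c x)) = exp (- (norm (b - c))\<^sup>2 / 8)"
  unfolding sqrt_gexp_mult by (auto simp: integrable_gexp integral_gexp_1)

lemma GDERIV_gexp: "GDERIV (gexp a) x :> gexp a x *\<^sub>R a"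
proof -
  have "GDERIV (\<lambda>x. a \<bullet> x - (norm a)\<^sup>2 / 2) x :> a"
    unfolding gderiv_def by (auto intro!: derivative_eq_intros simp: inner_commute)
  from GDERIV_DERIV_compose[OF this DERIV_exp] show ?thesis
    unfolding gexp_def[abs_def] .
qed

section \<open>Entropy and Wasserstein distance\<close>

lemma enn2ereal_enn2real: "x < \<top> \<Longrightarrow> enn2ereal x = ereal (enn2real x)"
  using enn2ereal_ennreal[OF enn2real_nonneg, of x] by simp

text \<open>Integrability makes both extended-valued parts finite, so their difference is an
  ordinary real one.\<close>

lemma rel_entropy_eq:
  assumes "integrable std_gaussian (\<lambda>x. f x * ln (f x))"
  shows "rel_entropy f = ereal (LINT x|std_gaussian. f x * ln (f x))"
proof -
  have "(\<integral>\<^sup>+ x. ennreal (f x * ln (f x)) \<partial>std_gaussian) < \<top>"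
    "(\<integral>\<^sup>+ x. ennreal (- (f x * ln (f x))) \<partial>std_gaussian) < \<top>"
    using assms by (auto simp: real_integrable_def top.not_eq_extremum)
  then show ?thesis
    unfolding rel_entropy_def real_lebesgue_integral_def[OF assms]
    by (simp only: enn2ereal_enn2real ereal_minus(1))
qed

section \<open>Couplings and a lower bound for the Wasserstein distance\<close>

text \<open>The product coupling. A lower bound for a real infimum requires a nonempty index
  set.\<close>

lemma couplings_nonempty:
  assumes "prob_space \<mu>" "prob_space \<nu>" "sets \<mu> = sets borel" "sets \<nu> = sets borel"
  shows "\<mu> \<Otimes>\<^sub>M \<nu> \<in> couplings \<mu> \<nu>"
proof -
  interpret M: prob_space \<mu> by fact
  interpret N: prob_space \<nu> by fact
  interpret P: pair_prob_space \<mu> \<nu> ..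
  note [measurable_cong] = assms(3,4)
  have sp: "space \<mu> = UNIV" "space \<nu> = UNIV"
    using sets_eq_imp_space_eq[OF assms(3)] sets_eq_imp_space_eq[OF assms(4)] by auto
  have sets: "sets (\<mu> \<Otimes>\<^sub>M \<nu>) = sets (borel \<Otimes>\<^sub>M borel)"
    using assms(3,4) by (rule sets_pair_measure_cong)
  have "distr (\<mu> \<Otimes>\<^sub>M \<nu>) borel fst = \<mu>"
  proof (rule measure_eqI)
    fix X assume "X \<in> sets (distr (\<mu> \<Otimes>\<^sub>M \<nu>) borel fst)"
    then have X: "X \<in> sets \<mu>" "X \<in> sets borel" by (auto simp: assms)
    have "fst -` X \<inter> space (\<mu> \<Otimes>\<^sub>M \<nu>) = X \<times> space \<nu>"
      by (auto simp: space_pair_measure sp)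
    then show "emeasure (distr (\<mu> \<Otimes>\<^sub>M \<nu>) borel fst) X = emeasure \<mu> X"
      using X by (simp add: emeasure_distr N.emeasure_pair_measure_Times N.emeasure_space_1)
  qed (simp add: assms)
  moreover have "distr (\<mu> \<Otimes>\<^sub>M \<nu>) borel snd = \<nu>"
  proof (rule measure_eqI)
    fix X assume "X \<in> sets (distr (\<mu> \<Otimes>\<^sub>M \<nu>) borel snd)"
    then have X: "X \<in> sets \<nu>" "X \<in> sets borel" by (auto simp: assms)
    have "snd -` X \<inter> space (\<mu> \<Otimes>\<^sub>M \<nu>) = space \<mu> \<times> X"
      by (auto simp: space_pair_measure sp)
    then show "emeasure (distr (\<mu> \<Otimes>\<^sub>M \<nu>) borel snd) X = emeasure \<nu> X"
      using X by (simp add: emeasure_distr N.emeasure_pair_measure_Times M.emeasure_space_1)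
  qed (simp add: assms)
  ultimately show ?thesis
    unfolding couplings_def using sets P.prob_space_axioms by auto
qed

lemma powr_add_le:
  fixes a b p :: real
  assumes "0 \<le> a" "0 \<le> b" "0 \<le> p"
  shows "(a + b) powr p \<le> 2 powr p * (a powr p + b powr p)"
proof -
  have "(a + b) powr p \<le> (2 * max a b) powr p"
    using assms by (intro powr_mono2) auto
  also have "\<dots> = 2 powr p * max a b powr p"
    using assms by (subst powr_mult) auto
  also have "\<dots> \<le> 2 powr p * (a powr p + b powr p)"
    by (intro mult_left_mono) (auto simp: max_def)
  finally show ?thesis .
qed

lemma le_1_plus_powr:
  fixes t p :: real
  assumes "0 \<le> t" "1 \<le> p"
  shows "t \<le> 1 + t powr p"
proof (cases "t \<le> 1")
  case False
  then have "t powr 1 \<le> t powr p" using assms by (intro powr_mono) auto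
  then show ?thesis using assms(1) by simp
qed (simp add: add_increasing2)

text \<open>The comparison \<open>t \<le> 1 + t powr p\<close> stands in for \<open>W\<^sub>1 \<le> W\<^sub>p\<close>.\<close>

lemma wasserstein_ge:
  fixes \<mu> \<nu> :: "(real ^ 'n) measure"
  assumes p: "1 \<le> p" and \<mu>: "\<mu> \<in> prob_moment p" and \<nu>: "\<nu> \<in> prob_moment p"
    and L: "0 \<le> L" "L + 1 \<le> (LINT x|\<mu>. norm x) - (LINT x|\<nu>. norm x)"
  shows "L powr (1 / p) \<le> wasserstein p \<mu> \<nu>"
  unfolding wasserstein_def
proof (rule cINF_greatest)
  show "couplings \<mu> \<nu> \<noteq> {}"
    using couplings_nonempty[of \<mu> \<nu>] \<mu> \<nu> by (auto simp: prob_moment_def)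
next
  fix \<pi> assume "\<pi> \<in> couplings \<mu> \<nu>"
  then have \<pi>: "prob_space \<pi>" and sets[measurable_cong]: "sets \<pi> = sets (borel \<Otimes>\<^sub>M borel)"
    and marg: "\<mu> = distr \<pi> borel fst" "\<nu> = distr \<pi> borel snd"
    by (auto simp: couplings_def)
  interpret prob_space \<pi> by fact
  have "integrable \<pi> (\<lambda>z. norm (fst z) powr p)" "integrable \<pi> (\<lambda>z. norm (snd z) powr p)"
    using \<mu> \<nu> unfolding marg prob_moment_def by (auto simp: integrable_distr_eq)
  note pow = this
  \<comment> \<open>Finite moments of order \<open>p\<close> give finite first moments.\<close>
  have one: "integrable \<pi> g" if [measurable]: "g \<in> borel_measurable \<pi>"
    and g: "integrable \<pi> (\<lambda>z. g z powr p)" "\<And>z. 0 \<le> g z" for g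
  proof (rule Bochner_Integration.integrable_bound[of \<pi> "\<lambda>z. 1 + g z powr p"])
    show "AE z in \<pi>. norm (g z) \<le> norm (1 + g z powr p)"
      using le_1_plus_powr[OF g(2) p] g(2) by (auto intro!: always_eventually)
  qed (use g(1) in auto)
  \<comment> \<open>Without integrability the Bochner integral of the cost would default to 0 and
    give no bound.\<close>
  have diffp: "integrable \<pi> (\<lambda>z. norm (fst z - snd z) powr p)"
  proof (rule Bochner_Integration.integrable_bound)
    show "integrable \<pi> (\<lambda>z. 2 powr p * (norm (fst z) powr p + norm (snd z) powr p))"
      using pow by auto
    have "norm (fst z - snd z) powr p \<le> 2 powr p * (norm (fst z) powr p + norm (snd z) powr p)" for z :: "(real^'n) \<times> (real^'n)"
      using powr_mono2[of p "norm (fst z - snd z)" "norm (fst z) + norm (snd z)"]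
        powr_add_le[of "norm (fst z)" "norm (snd z)" p] norm_triangle_ineq4[of "fst z" "snd z"] p
      by simp
    then show "AE z in \<pi>. norm (norm (fst z - snd z) powr p)
        \<le> norm (2 powr p * (norm (fst z) powr p + norm (snd z) powr p))"
      by (auto intro!: always_eventually)
  qed measurable
  have int1: "integrable \<pi> (\<lambda>z. norm (fst z))" "integrable \<pi> (\<lambda>z. norm (snd z))"
    using pow by (auto intro!: one)
  have "L + 1 \<le> (LINT z|\<pi>. norm (fst z)) - (LINT z|\<pi>. norm (snd z))"
    using L(2) unfolding marg by (simp add: integral_distr)
  also have "\<dots> = (LINT z|\<pi>. norm (fst z) - norm (snd z))"
    using int1 by simp
  \<comment> \<open>The constant 1 lost here is the one reserved in the hypothesis on
    \<open>L + 1\<close>.\<close>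
  also have "\<dots> \<le> (LINT z|\<pi>. 1 + norm (fst z - snd z) powr p)"
  proof (rule integral_mono)
    fix z
    show "norm (fst z) - norm (snd z) \<le> 1 + norm (fst z - snd z) powr p"
      using norm_triangle_ineq2[of "fst z" "snd z"] le_1_plus_powr[of "norm (fst z - snd z)" p] p
      by simp
  qed (use int1 diffp in auto)
  also have "\<dots> = 1 + (LINT z|\<pi>. norm (fst z - snd z) powr p)"
    using diffp by (simp add: prob_space)
  finally show "L powr (1 / p) \<le> (LINT z|\<pi>. norm (fst z - snd z) powr p) powr (1 / p)"
    using L(1) p by (intro powr_mono2) auto
qed

section \<open>Mixtures of two translates\<close>

locale gaussian_pair =
  fixes u v :: real and b c :: "real ^ 'n"
  assumes u_pos: "0 < u" and v_pos: "0 < v" and weights: "u + v = 1"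
    and barycenter: "u *\<^sub>R b + v *\<^sub>R c = 0"
begin

definition mix :: "real ^ 'n \<Rightarrow> real" where
  "mix x = u * gexp b x + v * gexp c x"

lemma mix_pos: "0 < mix x"
  using u_pos v_pos gexp_pos[of b x] gexp_pos[of c x] by (simp add: mix_def add_pos_pos)

lemma borel_measurable_mix[measurable]: "mix \<in> borel_measurable borel"
  unfolding mix_def[abs_def] by measurable

lemma integral_mix:
  fixes g :: "real ^ 'n \<Rightarrow> 'b::{banach, second_countable_topology}"
  assumes "\<And>a. integrable std_gaussian (\<lambda>x. gexp a x *\<^sub>R g x)"
  shows "integrable std_gaussian (\<lambda>x. mix x *\<^sub>R g x)"
    and "(LINT x|std_gaussian. mix x *\<^sub>R g x) =
      u *\<^sub>R (LINT x|std_gaussian. gexp b x *\<^sub>R g x) + v *\<^sub>R (LINT x|std_gaussian. gexp c x *\<^sub>R g x)"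
proof -
  have eq: "(\<lambda>x. mix x *\<^sub>R g x) = (\<lambda>x. u *\<^sub>R (gexp b x *\<^sub>R g x) + v *\<^sub>R (gexp c x *\<^sub>R g x))"
    by (simp add: mix_def scaleR_add_left)
  have i: "integrable std_gaussian (\<lambda>x. u *\<^sub>R (gexp b x *\<^sub>R g x))"
    "integrable std_gaussian (\<lambda>x. v *\<^sub>R (gexp c x *\<^sub>R g x))"
    by (intro integrable_scaleR_right assms)+
  show "integrable std_gaussian (\<lambda>x. mix x *\<^sub>R g x)"
    unfolding eq using i by (rule Bochner_Integration.integrable_add)
  show "(LINT x|std_gaussian. mix x *\<^sub>R g x) =
      u *\<^sub>R (LINT x|std_gaussian. gexp b x *\<^sub>R g x) + v *\<^sub>R (LINT x|std_gaussian. gexp c x *\<^sub>R g x)"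
    unfolding eq Bochner_Integration.integral_add[OF i] by (simp only: integral_scaleR_right)
qed

lemma integrable_mix: "integrable std_gaussian mix"
  and integral_mix_1: "(LINT x|std_gaussian. mix x) = 1"
  using integral_mix[of "\<lambda>_. 1::real"] weights by (simp_all add: integrable_gexp integral_gexp_1)

lemma sets_gauss_measure_mix: "sets (gauss_measure mix) = sets borel"
  by (simp add: gauss_measure_def)

lemma prob_space_gauss_measure_mix: "prob_space (gauss_measure mix)"
proof
  have "(\<integral>\<^sup>+ x. ennreal (mix x) \<partial>std_gaussian) = ennreal (LINT x|std_gaussian. mix x)"
    using integrable_mix mix_pos by (intro nn_integral_eq_integral) (auto simp: less_imp_le)
  then show "emeasure (gauss_measure mix) (space (gauss_measure mix)) = 1"
    by (simp add: gauss_measure_def emeasure_density integral_mix_1)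
qed

lemma integral_gauss_measure_mix:
  fixes g :: "real ^ 'n \<Rightarrow> 'b::{banach, second_countable_topology}"
  assumes [measurable]: "g \<in> borel_measurable borel"
  shows "(LINT x|gauss_measure mix. g x) = (LINT x|std_gaussian. mix x *\<^sub>R g x)"
  unfolding gauss_measure_def
  by (subst integral_density) (auto simp: mix_pos less_imp_le)

lemma gauss_measure_mix_prob_moment:
  assumes "0 \<le> p"
  shows "gauss_measure mix \<in> prob_moment p"
proof -
  have "integrable std_gaussian (\<lambda>x. mix x *\<^sub>R (norm x powr p))"
    using powr_le_exp[OF norm_ge_zero assms]
    by (intro integral_mix(1) integrable_gexp_scaleR[of _ 1 p]) auto
  then have "integrable (gauss_measure mix) (\<lambda>x. norm x powr p)"
    unfolding gauss_measure_def
    by (subst integrable_density) (auto simp: mix_pos less_imp_le)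
  then show ?thesis
    using prob_space_gauss_measure_mix sets_gauss_measure_mix by (simp add: prob_moment_def)
qed

lemma centered_gauss_measure_mix: "centered (gauss_measure mix)"
  unfolding centered_def
  by (subst integral_gauss_measure_mix)
    (simp_all add: integral_mix(2) integrable_gexp_id integral_gexp_id barycenter)

text \<open>The norm of a mean is at most the mean of the norm, so the translate by \<open>a\<close>
  has first moment at least \<open>norm a\<close>. The contribution of \<open>b\<close> is
  dropped.\<close>

lemma first_moment_mix: "v * norm c \<le> (LINT x|gauss_measure mix. norm x)"
proof -
  have i: "integrable std_gaussian (\<lambda>x. gexp a x *\<^sub>R norm x)" for a :: "real ^ 'n"
    by (rule integrable_gexp_scaleR[of _ 1 1]) (auto intro: le_exp)
  have "norm a \<le> (LINT x|std_gaussian. gexp a x *\<^sub>R norm x)" for a :: "real ^ 'n"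
    using integral_norm_bound[of std_gaussian "\<lambda>x. gexp a x *\<^sub>R x"]
    by (simp add: integral_gexp_id gexp_nonneg)
  then have "u *\<^sub>R norm b + v *\<^sub>R norm c \<le> (LINT x|std_gaussian. mix x *\<^sub>R norm x)"
    unfolding integral_mix(2)[OF i] using u_pos v_pos
    by (intro add_mono scaleR_left_mono) auto
  then have "u * norm b + v * norm c \<le> (LINT x|gauss_measure mix. norm x)"
    by (simp add: integral_gauss_measure_mix)
  then show ?thesis
    using u_pos by (simp add: add_increasing order_trans[rotated])
qed

section \<open>Entropy of the mixture\<close>

text \<open>The mixture is at least each of its weighted components, and \<open>ln\<close> is
  monotone. Splitting the logarithm of a weighted component produces the terms
  \<open>u * ln u\<close> and \<open>v * ln v\<close>.\<close>

lemma mix_ln_lower: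
  "u * (gexp b x * ln (gexp b x)) + v * (gexp c x * ln (gexp c x))
     + (u * ln u) * gexp b x + (v * ln v) * gexp c x \<le> mix x * ln (mix x)"
proof -
  have "ln (u * gexp b x) \<le> ln (mix x)" "ln (v * gexp c x) \<le> ln (mix x)"
    using u_pos v_pos gexp_pos[of b x] gexp_pos[of c x] mix_pos[of x]
    by (auto simp: mix_def)
  then have "(u * gexp b x) * ln (u * gexp b x) + (v * gexp c x) * ln (v * gexp c x)
      \<le> (u * gexp b x) * ln (mix x) + (v * gexp c x) * ln (mix x)"
    using u_pos v_pos gexp_nonneg[of b x] gexp_nonneg[of c x]
    by (intro add_mono mult_left_mono) auto
  then show ?thesis
    using u_pos v_pos gexp_pos[of b x] gexp_pos[of c x]
    by (simp add: mix_def ln_mult algebra_simps)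
qed

text \<open>Convexity of \<open>t * ln t\<close>, proved through the tangent inequality
  \<open>*\<close>. The linear error terms cancel on averaging because
  \<open>u + v = 1\<close>.\<close>

lemma mix_ln_upper:
  "mix x * ln (mix x) \<le> u * (gexp b x * ln (gexp b x)) + v * (gexp c x * ln (gexp c x))"
proof -
  have *: "F * ln (mix x) \<le> F * ln F + (mix x - F)" if "0 < F" for F
  proof -
    have "ln (mix x / F) \<le> mix x / F - 1"
      using that mix_pos[of x] by (intro ln_le_minus_one) auto
    then have "F * (ln (mix x) - ln F) \<le> F * (mix x / F - 1)"
      using that mix_pos[of x] by (intro mult_left_mono) (auto simp: ln_div)
    then show ?thesis using that by (simp add: algebra_simps)
  qed
  have "mix x * ln (mix x) = u * (gexp b x * ln (mix x)) + v * (gexp c x * ln (mix x))"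
    by (simp add: mix_def algebra_simps)
  also have "\<dots> \<le> u * (gexp b x * ln (gexp b x) + (mix x - gexp b x))
      + v * (gexp c x * ln (gexp c x) + (mix x - gexp c x))"
    using u_pos v_pos by (intro add_mono mult_left_mono * gexp_pos) auto
  also have "\<dots> = u * (gexp b x * ln (gexp b x)) + v * (gexp c x * ln (gexp c x))
      + ((u + v) * mix x - (u * gexp b x + v * gexp c x))"
    by (simp add: algebra_simps)
  also have "(u + v) * mix x - (u * gexp b x + v * gexp c x) = 0"
    by (simp add: weights mix_def)
  finally show ?thesis by simp
qed

text \<open>The second moment of the two shifts under the weights. Half of it is the average entropy
  of the translates.\<close>

definition energy :: real where
  "energy = u * (norm b)\<^sup>2 + v * (norm c)\<^sup>2"

text \<open>The pointwise bounds \<open>L\<close> and \<open>U\<close> are integrable with explicit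
  integrals. They first give integrability of the function between them and then both
  inequalities.\<close>

lemma integrable_mix_ln: "integrable std_gaussian (\<lambda>x. mix x * ln (mix x))"
  and integral_mix_ln_lower: "energy / 2 + (u * ln u + v * ln v) \<le> (LINT x|std_gaussian. mix x * ln (mix x))"
  and integral_mix_ln_upper: "(LINT x|std_gaussian. mix x * ln (mix x)) \<le> energy / 2"
proof -
  define U where "U x = u * (gexp b x * ln (gexp b x)) + v * (gexp c x * ln (gexp c x))" for x
  define L where "L x = U x + ((u * ln u) * gexp b x + (v * ln v) * gexp c x)" for x
  have LU: "L x \<le> mix x * ln (mix x)" "mix x * ln (mix x) \<le> U x" for x
    using mix_ln_lower[of x] mix_ln_upper[of x] by (auto simp: L_def U_def)
  note i = integrable_mult_right[OF integrable_gexp_ln] integrable_mult_right[OF integrable_gexp]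
  have iU: "integrable std_gaussian U"
    unfolding U_def by (intro Bochner_Integration.integrable_add i)
  have iL: "integrable std_gaussian L"
    unfolding L_def by (intro Bochner_Integration.integrable_add i iU)
  show int: "integrable std_gaussian (\<lambda>x. mix x * ln (mix x))"
  proof (rule Bochner_Integration.integrable_bound)
    show "integrable std_gaussian (\<lambda>x. \<bar>L x\<bar> + \<bar>U x\<bar>)"
      using iU iL by auto
    show "AE x in std_gaussian. norm (mix x * ln (mix x)) \<le> norm (\<bar>L x\<bar> + \<bar>U x\<bar>)"
    proof (intro always_eventually allI)
      show "norm (mix x * ln (mix x)) \<le> norm (\<bar>L x\<bar> + \<bar>U x\<bar>)" for x
        using LU[of x] unfolding real_norm_def by linarith
    qed
  qed measurable
  have U: "(LINT x|std_gaussian. U x) = energy / 2"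
    unfolding U_def energy_def
    by (subst Bochner_Integration.integral_add[OF i(1) i(1)])
      (simp add: integral_gexp_ln add_divide_distrib)
  have "(LINT x|std_gaussian. L x) = (LINT x|std_gaussian. U x) + (u * ln u + v * ln v)"
    unfolding L_def
    by (subst Bochner_Integration.integral_add[OF iU Bochner_Integration.integrable_add[OF i(2) i(2)]],
      subst Bochner_Integration.integral_add[OF i(2) i(2)]) (simp add: integral_gexp_1)
  then show "energy / 2 + (u * ln u + v * ln v) \<le> (LINT x|std_gaussian. mix x * ln (mix x))"
    using integral_mono[OF iL int LU(1)] U by simp
  show "(LINT x|std_gaussian. mix x * ln (mix x)) \<le> energy / 2"
    using integral_mono[OF int iU LU(2)] U by simp
qed

section \<open>Fisher information and deficit of the mixture\<close>

definition grad_mix :: "real ^ 'n \<Rightarrow> real ^ 'n" where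
  "grad_mix x = (u * gexp b x) *\<^sub>R b + (v * gexp c x) *\<^sub>R c"

lemma GDERIV_mix: "GDERIV mix x :> grad_mix x"
proof -
  have "GDERIV (\<lambda>x. u * gexp b x + v * gexp c x) x :>
      (u *\<^sub>R (gexp b x *\<^sub>R b) + gexp b x *\<^sub>R 0) + (v *\<^sub>R (gexp c x *\<^sub>R c) + gexp c x *\<^sub>R 0)"
    by (intro GDERIV_add GDERIV_mult GDERIV_const GDERIV_gexp)
  then show ?thesis by (simp add: mix_def[abs_def] grad_mix_def)
qed

lemma continuous_grad_mix: "continuous_on UNIV grad_mix"
  unfolding grad_mix_def by (intro continuous_intros GDERIV_continuous_on[OF GDERIV_gexp])

text \<open>A variance identity: \<open>grad_mix x / mix x\<close> is the mean of \<open>b\<close>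
  and \<open>c\<close> under the weights \<open>u * gexp b x / mix x\<close> and
  \<open>v * gexp c x / mix x\<close>, and its square is their second moment minus their
  variance.\<close>

lemma grad_mix_sq:
  "(norm (grad_mix x))\<^sup>2 / mix x = u * (norm b)\<^sup>2 * gexp b x + v * (norm c)\<^sup>2 * gexp c x
     - u * v * (norm (b - c))\<^sup>2 * (gexp b x * gexp c x / mix x)"
proof -
  have "(norm (grad_mix x))\<^sup>2 = (u * (norm b)\<^sup>2 * gexp b x + v * (norm c)\<^sup>2 * gexp c x) * mix x
     - u * v * (norm (b - c))\<^sup>2 * (gexp b x * gexp c x)"
    unfolding power2_norm_eq_inner grad_mix_def mix_def
    by (simp add: inner_diff inner_add inner_commute algebra_simps)
  then show ?thesis
    using mix_pos[of x] by (simp add: diff_divide_distrib)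
qed

text \<open>By the inequality of arithmetic and geometric means \<open>mix x\<close> is at least
  \<open>2 * sqrt (u * v)\<close> times the geometric mean of the translates, while the numerator is
  the square of that mean.\<close>

lemma overlap_bound:
  "0 \<le> gexp b x * gexp c x / mix x"
  "gexp b x * gexp c x / mix x \<le> sqrt (gexp b x * gexp c x) / (2 * sqrt (u * v))"
proof -
  show "0 \<le> gexp b x * gexp c x / mix x"
    using mix_pos[of x] gexp_pos[of b x] gexp_pos[of c x] by simp
  define s where "s = sqrt (gexp b x * gexp c x)"
  have s: "0 < s" "gexp b x * gexp c x = s * s"
    using gexp_pos[of b x] gexp_pos[of c x] by (auto simp: s_def)
  have r: "0 < sqrt (u * v)" using u_pos v_pos by simp
  have "sqrt ((u * gexp b x) * (v * gexp c x)) \<le> (u * gexp b x + v * gexp c x) / 2"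
    using u_pos v_pos gexp_nonneg[of b x] gexp_nonneg[of c x] by (intro arith_geo_mean_sqrt) auto
  then have le: "2 * sqrt (u * v) * s \<le> mix x"
    by (simp add: mix_def s_def real_sqrt_mult mult_ac)
  then have "s * (2 * sqrt (u * v) * s) \<le> s * mix x"
    using s(1) by (intro mult_left_mono) auto
  then show "gexp b x * gexp c x / mix x \<le> sqrt (gexp b x * gexp c x) / (2 * sqrt (u * v))"
    using r s(1) mix_pos[of x] unfolding s_def[symmetric] s(2) by (simp add: field_simps)
qed

text \<open>The Fisher information is \<open>energy\<close> minus a nonnegative overlap term.
  Dropping that term and using the lower entropy bound gives the upper estimate; bounding it and
  using the upper entropy bound gives the lower one. A real \<open>\<delta>\<close> is exposed so
  that limits can be taken in the reals.\<close>

lemma lsi_deficit_mix: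
  obtains \<delta> where "lsi_deficit mix = ereal \<delta>"
    "\<delta> \<le> - (u * ln u + v * ln v)"
    "- (sqrt (u * v) * (norm (b - c))\<^sup>2 * exp (- (norm (b - c))\<^sup>2 / 8) / 4) \<le> \<delta>"
proof -
  define d where "d = (norm (b - c))\<^sup>2"
  define q where "q x = gexp b x * gexp c x / mix x" for x
  define J where "J = (LINT x|std_gaussian. q x)"
  define H where "H = (LINT x|std_gaussian. mix x * ln (mix x))"
  note s = sqrt_gexp_mult_integral[of b c]
  have iq: "integrable std_gaussian q"
  proof (rule Bochner_Integration.integrable_bound)
    show "integrable std_gaussian (\<lambda>x. sqrt (gexp b x * gexp c x) / (2 * sqrt (u * v)))"
      using s(1) by simp
    show "AE x in std_gaussian. norm (q x) \<le> norm (sqrt (gexp b x * gexp c x) / (2 * sqrt (u * v)))"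
    proof (intro always_eventually allI)
      show "norm (q x) \<le> norm (sqrt (gexp b x * gexp c x) / (2 * sqrt (u * v)))" for x
        using overlap_bound[of x] unfolding q_def real_norm_def by linarith
    qed
    show "q \<in> borel_measurable std_gaussian" unfolding q_def by measurable
  qed
  have J0: "0 \<le> J"
    unfolding J_def q_def by (intro Bochner_Integration.integral_nonneg overlap_bound(1))
  have "J \<le> (LINT x|std_gaussian. sqrt (gexp b x * gexp c x) / (2 * sqrt (u * v)))"
    unfolding J_def using iq s(1) overlap_bound(2) by (intro integral_mono) (auto simp: q_def)
  then have J1: "J \<le> exp (- d / 8) / (2 * sqrt (u * v))"
    using s(2) by (simp add: d_def)
  have "u * v * d * J \<le> u * v * d * (exp (- d / 8) / (2 * sqrt (u * v)))"
    using u_pos v_pos J1 by (intro mult_left_mono) (auto simp: d_def)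
  also have "\<dots> = (u * v / sqrt (u * v)) * d * exp (- d / 8) / 2"
    by simp
  also have "u * v / sqrt (u * v) = sqrt (u * v)"
    using u_pos v_pos by (intro real_div_sqrt) simp
  finally have J2: "u * v * d * J \<le> sqrt (u * v) * d * exp (- d / 8) / 2" .
  have J3: "0 \<le> u * v * d * J" using u_pos v_pos J0 by (simp add: d_def)
  define I where "I = energy - u * v * d * J"
  have i: "integrable std_gaussian (\<lambda>x. u * (norm b)\<^sup>2 * gexp b x)"
    "integrable std_gaussian (\<lambda>x. v * (norm c)\<^sup>2 * gexp c x)"
    "integrable std_gaussian (\<lambda>x. u * v * d * q x)"
    using iq by (auto simp: integrable_gexp)
  note i12 = Bochner_Integration.integrable_add[OF i(1,2)]
  have I: "(LINT x|std_gaussian. (norm (grad_mix x))\<^sup>2 / mix x) = I"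
  proof -
    have "(LINT x|std_gaussian. (norm (grad_mix x))\<^sup>2 / mix x) =
      (LINT x|std_gaussian. (u * (norm b)\<^sup>2 * gexp b x + v * (norm c)\<^sup>2 * gexp c x) - u * v * d * q x)"
      by (simp add: grad_mix_sq q_def d_def)
    also have "\<dots> = I"
      unfolding Bochner_Integration.integral_diff[OF i12 i(3)] Bochner_Integration.integral_add[OF i(1,2)]
      by (simp add: I_def energy_def integral_gexp_1 J_def)
    finally show ?thesis .
  qed
  \<comment> \<open>Needed to recover \<open>I\<close> from \<open>ennreal I\<close>, since
    \<open>ennreal\<close> truncates negative values.\<close>
  have I_nonneg: "0 \<le> I"
    unfolding I[symmetric] using mix_pos
    by (intro Bochner_Integration.integral_nonneg) (simp add: less_imp_le)
  have "fisher_information mix = (\<integral>\<^sup>+ x. ennreal ((norm (grad_mix x))\<^sup>2 / mix x) \<partial>std_gaussian)"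
    by (rule fisher_information_eq[OF GDERIV_mix continuous_grad_mix])
  also have "\<dots> = ennreal I"
    unfolding I[symmetric]
  proof (rule nn_integral_eq_integral)
    show "integrable std_gaussian (\<lambda>x. (norm (grad_mix x))\<^sup>2 / mix x)"
      unfolding grad_mix_sq using Bochner_Integration.integrable_diff[OF i12 i(3)]
      by (simp add: q_def d_def)
  qed (auto simp: mix_pos less_imp_le)
  finally have fisher: "fisher_information mix = ennreal I" .
  have "enn2ereal (fisher_information mix) = ereal I"
    unfolding fisher by (rule enn2ereal_ennreal[OF I_nonneg])
  then have "lsi_deficit mix = ereal (I / 2 - H)"
    unfolding lsi_deficit_def rel_entropy_eq[OF integrable_mix_ln] H_def[symmetric] by simp
  then show ?thesis
  proof (rule that)
    show "I / 2 - H \<le> - (u * ln u + v * ln v)"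
      using J3 integral_mix_ln_lower unfolding I_def H_def diff_divide_distrib by linarith
    show "- (sqrt (u * v) * (norm (b - c))\<^sup>2 * exp (- (norm (b - c))\<^sup>2 / 8) / 4) \<le> I / 2 - H"
      using J2 integral_mix_ln_upper unfolding I_def H_def diff_divide_distrib d_def[symmetric] by linarith
  qed
qed

end

section \<open>The sequence of mixtures, its deficit and its distance from the Gaussian\<close>

theorem theorem1p3:
  fixes p :: real
  assumes "p \<ge> 1"
  shows "\<exists>f :: nat \<Rightarrow> real ^ 'n \<Rightarrow> real.
    (\<forall>k. (\<forall>x. 0 \<le> f k x) \<and> integrable std_gaussian (f k) \<and>
         gauss_measure (f k) \<in> prob_moment 2 \<and>
         gauss_measure (f k) \<in> prob_moment p \<and>
         centered (gauss_measure (f k))) \<and>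
    (\<lambda>k. lsi_deficit (f k)) \<longlonglongrightarrow> 0 \<and>
    filterlim (\<lambda>k. wasserstein p (gauss_measure (f k)) std_gaussian) at_top sequentially"
proof -
  obtain e :: "real ^ 'n" where e: "norm e = 1"
    using vector_choose_size[of 1] by auto
  \<comment> \<open>The offset 2 keeps both weights strictly positive from \<open>k = 0\<close> on;
    at \<open>N k = 1\<close> the weight \<open>u k\<close> would vanish.\<close>
  define N where "N k = real k + 2" for k :: nat
  define u where "u k = 1 - 1 / N k" for k
  define v where "v k = 1 / N k" for k
  define b where "b k = (- N k) *\<^sub>R e" for k
  \<comment> \<open>Forced by the barycenter condition: \<open>c k\<close> is
    \<open>- (u k / v k)\<close> times \<open>b k\<close>.\<close>
  define c where "c k = (N k * (N k - 1)) *\<^sub>R e" for k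
  have N: "2 \<le> N k" for k by (simp add: N_def)
  interpret G: gaussian_pair "u k" "v k" "b k" "c k" for k
  proof
    show "0 < u k" "0 < v k" "u k + v k = 1"
      using N[of k] by (auto simp: u_def v_def field_simps)
    show "u k *\<^sub>R b k + v k *\<^sub>R c k = 0"
    proof -
      have "u k * (- N k) + v k * (N k * (N k - 1)) = 0"
        using N[of k] by (simp add: u_def v_def field_simps)
      then show ?thesis
        by (simp add: b_def c_def flip: scaleR_add_left)
    qed
  qed
  have norm_diff: "norm (b k - c k) = (N k)\<^sup>2" for k
  proof -
    have "b k - c k = (- (N k)\<^sup>2) *\<^sub>R e"
      by (simp add: b_def c_def power2_eq_square algebra_simps flip: scaleR_diff_left)
    then show ?thesis using e by simp
  qed
  have "\<exists>\<delta>. lsi_deficit (G.mix k) = ereal \<delta> \<and> \<delta> \<le> - (u k * ln (u k) + v k * ln (v k)) \<and>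
      - (sqrt (u k * v k) * ((N k)\<^sup>2)\<^sup>2 * exp (- ((N k)\<^sup>2)\<^sup>2 / 8) / 4) \<le> \<delta>" for k
    using G.lsi_deficit_mix[of k] unfolding norm_diff by metis
  then obtain \<delta> where \<delta>: "\<And>k. lsi_deficit (G.mix k) = ereal (\<delta> k)"
    "\<And>k. \<delta> k \<le> - (u k * ln (u k) + v k * ln (v k))"
    "\<And>k. - (sqrt (u k * v k) * ((N k)\<^sup>2)\<^sup>2 * exp (- ((N k)\<^sup>2)\<^sup>2 / 8) / 4) \<le> \<delta> k"
    by metis
  \<comment> \<open>Below, \<open>exp (- ((N k)\<^sup>2)\<^sup>2 / 8)\<close> beats the polynomial
    factor; above, the entropy of the weights is of order \<open>ln (N k) / N k\<close>.\<close>
  have "\<delta> \<longlonglongrightarrow> 0"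
  proof (rule tendsto_sandwich)
    show "(\<lambda>k. - (sqrt (u k * v k) * ((N k)\<^sup>2)\<^sup>2 * exp (- ((N k)\<^sup>2)\<^sup>2 / 8) / 4)) \<longlonglongrightarrow> 0"
      unfolding u_def v_def N_def by real_asymp
    show "(\<lambda>k. - (u k * ln (u k) + v k * ln (v k))) \<longlonglongrightarrow> 0"
      unfolding u_def v_def N_def by real_asymp
  qed (use \<delta> in auto)
  then have deficit: "(\<lambda>k. lsi_deficit (G.mix k)) \<longlonglongrightarrow> 0"
    unfolding \<delta>(1) zero_ereal_def by (rule tendsto_ereal)
  define m where "m = (LINT x|(std_gaussian :: (real ^ 'n) measure). norm x)"
  have gauss: "(std_gaussian :: (real ^ 'n) measure) \<in> prob_moment p"
    using prob_space_std_gaussian powr_le_exp[OF norm_ge_zero, of p] assms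
    by (auto simp: prob_moment_def intro!: integrable_std_gaussian_exp_bound[of _ 1 p])
  have "filterlim (\<lambda>k. wasserstein p (gauss_measure (G.mix k)) std_gaussian) at_top sequentially"
  proof (rule filterlim_at_top_mono)
    \<comment> \<open>The mixture has first moment at least \<open>N k - 1\<close> and the Gaussian
      has \<open>m\<close>, so \<open>L = N k - 2 - m\<close> is admissible in
      \<open>wasserstein_ge\<close> once it is nonnegative.\<close>
    show "filterlim (\<lambda>k. (N k - 2 - m) powr (1 / p)) at_top sequentially"
      unfolding N_def using assms by real_asymp
    have "eventually (\<lambda>k. 0 \<le> N k - 2 - m) sequentially"
      unfolding N_def by real_asymp
    then show "eventually (\<lambda>k. (N k - 2 - m) powr (1 / p)
        \<le> wasserstein p (gauss_measure (G.mix k)) std_gaussian) sequentially"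
    proof eventually_elim
      case (elim k)
      have "v k * norm (c k) = N k - 1"
        using N[of k] e by (simp add: v_def c_def)
      then show ?case
        using elim G.first_moment_mix[of k] assms
        by (intro wasserstein_ge gauss G.gauss_measure_mix_prob_moment) (auto simp: m_def)
    qed
  qed
  then show ?thesis
    using G.mix_pos G.integrable_mix G.gauss_measure_mix_prob_moment
      G.centered_gauss_measure_mix deficit assms
    by (intro exI[of _ G.mix] conjI allI) (auto simp: less_imp_le)
qed

end
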